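(* Let $d\ge2$, $n\ge1$, $m\ge1$ be integers, $N=d^n$, and let $t,f$ be integers with $0\le t<n$, $1\le f\le N$. For integers $k,p,q$ with $1\le k\le\min(f,d^t)$, $0\le p\le n-t-1$, $n-t\le q\le n$, put $\mu=\min\{d^t-k,\;k(d^{n-q}-1)\}$ and define $g(k,p,q)$ by: - if $t\ge\lceil n/2\rceil$ and $q=n-t$: $g=f(d^p-1)+(n-t-p)(d^{n-t+1}-d^{n-t})-d^{n-t}+d^p+d^t-k$; - if $t\ge\lceil n/2\rceil$ and $q>n-t$: $g=f(d^p-1)+(n-t-p)(d^{n-t+1}-d^{n-t})-d^{n-t}+d^{q}+\mu$; - if $p+1\le t\le\lceil n/2\rceil-1$ and $q=n-t$: $g=f(d^p-1)+(t-p)(d^{n-t+1}-d^{n-t})+d^{n+p-2t}-k$; - if $p+1\le t\le\lceil n/2\rceil-1$ and $q>n-t$: $g=f(d^p-1)+(t-p)(d^{n-t+1}-d^{n-t})+d^{n+p-2t}-d^t+d^{q}-d^p+\mu$; - if $t\le p$ and $q=n-t$: $g=f(d^p-1)+d^{n-p}-k$; - if $t\le p$ and $q>n-t$: $g=f(d^p-1)+d^{n-p}-d^t+d^{q}-d^p+\mu$. Then: (i) For every input $\mathbf a$, every $B\subseteq W_0$ with $|B|=k$, $1\le k\le\min(f,d^t)$, and all integers $p,q$ with $0\le p\le n-t-1$ and $n-t\le q\le n$, the solution $S_{p,q}$ described in the context is feasible for the linear program (D) in the context, with objective value equal to $g(k,p,q)$. (ii) Consequently, for the network $\log_d(N,0,m)$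 to be crosstalk-free $f$-cast wide-sense nonblocking under the window algorithm with window size $d^t$, it is sufficient that $$m\ \ge\ 1+\max_{1\le k\le\min(f,d^t)}\ \min_{\substack{0\le p\le n-t-1\\ n-t\le q\le n}} g(k,p,q).$$
   Context: Network. Let $\mathbb Z_d=\{0,\dots,d-1\}$; for a string $\mathbf s$, $\mathbf s_{i..j}=s_i\cdots s_j$. The $d$-ary inverse Banyan network $\mathrm{BY}^{-1}(n)$ has $N=d^n$ inputs and $N$ outputs, each labelled by the strings in $\mathbb Z_d^n$, and $n$ stages of $d\times d$ switching elements (SEs), the SEs of each stage being labelled by $\mathbb Z_d^{n-1}$. Input $\mathbf x$ is attached to the stage-$1$ SE $\mathbf x_{1..n-1}$ and output $\mathbf y$ to the stage-$n$ SE $\mathbf y_{1..n-1}$. For $1\le i\le n-1$, the stage-$i$ SE $\mathbf z$ is joined by one link to each of the $d$ stage-$(i+1)$ SEs whose labels agree with $\mathbf z$ in all positions except possibly position $i$. The unique route $R(\mathbf x,\mathbf y)$ passes at stage $j$ through the SE $y_1\cdots y_{j-1}x_j\cdots x_{n-1}$. The network $\log_d(N,0,m)$ consists of $m$ parallel copies (planes) of $\mathrm{BY}^{-1}(n)$; each network input is connected, through a $1\times m$ element with fanout capability, to the equally labelled input of every plane, and each network output is connected to the equally labelled output of every plane. Requests. An $f$-cast request is a pair $(\mathbf a,B)$, with $\mathbf a$ an input not involved in any existing request and $B$ a nonempty set of at most $f$ outputs, none involved in an existing request. Routing a (sub)request $(\mathbf a,B')$ on a plane means using on that plane the union of the routes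 $R(\mathbf a,\mathbf b)$, $\mathbf b\in B'$. Crosstalk-free constraint: on the same plane, routes belonging to different requests (i.e. from different inputs) may not share a switching element; routes from the same input may. Window algorithm with window size $d^t$. The outputs are divided into $d^{n-t}$ windows $W_0,\dots,W_{d^{n-t}-1}$ of size $d^t$, each consisting of all outputs sharing a given prefix of length $n-t$. Rule: for every request $(\mathbf a,B)$ and every $w$, the subrequest $(\mathbf a,B\cap W_w)$ is routed entirely on one single plane (different subrequests may use the same or different planes). The network is crosstalk-free $f$-cast wide-sense nonblocking under the window algorithm if, whenever $f$-cast requests arrive and depart in arbitrary order and all existing requests have been routed following the rule and the crosstalk-free constraint, every new $f$-cast request can be routed following the rule and the crosstalk-free constraint without disturbing existing routes. Notation for (i). Fix an input $\mathbf a$ and $B=\{\mathbf b^{(1)},\dots,\mathbf b^{(k)}\}\subseteq W_0$. For $0\le i\le n-1$, $A_i$ is the set of inputs $\mathbf u\ne\mathbf a$ such that the longest common suffix of $\mathbf u_{1..n-1}$ and $\mathbf a_{1..n-1}$ has length exactly $i$; $\mathcal A=\bigcup_i A_i$, and $i(\mathbf u)$ is the index with $\mathbf u\in A_{i(\mathbf u)}$. For $0\le j\le n-1$, $B_j$ is the set of outputs $\mathbf v\notin B$ such that for some $l$ the longest common prefix of $\mathbf v_{1..n-1}$ and $\mathbf b^{(l)}_{1..n-1}$ has length exactly $j$. For $1\le w\le d^{n-t}-1$, $j(w)$ is the index $j$ with $W_w\subseteq B_j$ (one has $j(w)\le n-t-1$); for $\mathbf v\in W_0-B$, $j(\mathbf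 v)$ is the largest $j$ with $\mathbf v\in B_j$ (one has $j(\mathbf v)\ge n-t$). Linear program (D): variables $\alpha_w$ ($1\le w\le d^{n-t}-1$), $\beta_{\mathbf u,w}$ (for pairs $\mathbf u\in\mathcal A$, $w$ with $i(\mathbf u)+j(w)\ge n-1$), $\gamma_{\mathbf u},\epsilon_{\mathbf u}$ ($\mathbf u\in\mathcal A$), $\delta_{\mathbf v}$ ($\mathbf v\in W_0-B$), all $\ge0$; minimize $$\sum_w d^t\alpha_w+\sum_{\mathbf u,w}\beta_{\mathbf u,w}+\sum_{\mathbf u}\gamma_{\mathbf u}+\sum_{\mathbf v}\delta_{\mathbf v}+\sum_{\mathbf u}f\epsilon_{\mathbf u}$$ subject to $\alpha_w+\beta_{\mathbf u,w}+\epsilon_{\mathbf u}\ge1$ for all $\mathbf u\in\mathcal A$, $1\le w\le d^{n-t}-1$ with $i(\mathbf u)+j(w)\ge n-1$, and $\gamma_{\mathbf u}+\delta_{\mathbf v}+\epsilon_{\mathbf u}\ge1$ for all $\mathbf u\in\mathcal A$, $\mathbf v\in W_0-B$ with $i(\mathbf u)+j(\mathbf v)\ge n-1$. Solution $S_{p,q}$ (all variables not mentioned are $0$): - $\epsilon_{\mathbf u}=1$ if $i(\mathbf u)\ge n-p$. - If $t\ge\lceil n/2\rceil$: $\beta_{\mathbf u,w}=1$ whenever $p\le j(w)\le n-t-1$ and $n-1-j(w)\le i(\mathbf u)\le n-p-1$. If $p+1\le t\le\lceil n/2\rceil-1$: $\beta_{\mathbf u,w}=1$ whenever $p\le j(w)\le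 t-1$ and $n-1-j(w)\le i(\mathbf u)\le n-p-1$, and $\alpha_w=1$ whenever $t\le j(w)\le n-t-1$. If $t\le p$: $\alpha_w=1$ whenever $p\le j(w)\le n-t-1$. - If $q=n-t$: $\delta_{\mathbf v}=1$ for all $\mathbf v\in\bigcup_{j=n-t}^{n-1}B_j=W_0-B$. If $q\ge n-t+1$: $\delta_{\mathbf v}=1$ for all $\mathbf v\in\bigcup_{j=q}^{n-1}B_j$, and $\gamma_{\mathbf u}=1$ for all $\mathbf u$ with $n-q\le i(\mathbf u)\le n-p-1$.
   Formalization: In (i), equality with g(k,p,q) can fail for q>n-t, as μ is only the maximum of |∪_{j≥q}B_j|. Proved instead: objective ≤ g, equal to g if q=n-t and to g-(μ-|∪_{j=q}^{n-1}B_j|) if q>n-t; for all a,k some B attains g for all p,q. *)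

theory Defs
  imports Complex_Main "HOL-Library.Sublist"
begin

section \<open>The inverse Banyan network\<close>

text \<open>A string \<open>s\<^sub>1 \<dots> s\<^sub>n\<close> over \<open>{0, \<dots>, d - 1}\<close> is a list, so position \<open>i\<close> of the string is
  list index \<open>i - 1\<close>, and \<open>s\<^sub>1 \<dots> s\<^sub>i\<close> is \<open>take i s\<close>. Stages are numbered from 1.\<close>

definition strings :: "nat \<Rightarrow> nat \<Rightarrow> nat list set" where
  "strings d n = {s. set s \<subseteq> {..<d} \<and> length s = n}"

text \<open>Links between stage \<open>i\<close> and stage \<open>i + 1\<close>.\<close>

definition link :: "nat \<Rightarrow> nat \<Rightarrow> nat \<Rightarrow> nat list \<Rightarrow> nat list \<Rightarrow> bool" where
  "link d n i z z' \<longleftrightarrow>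
     z \<in> strings d (n - 1) \<and> z' \<in> strings d (n - 1) \<and>
     (\<forall>l\<in>{1..n - 1}. l \<noteq> i \<longrightarrow> z ! (l - 1) = z' ! (l - 1))"

definition is_route :: "nat \<Rightarrow> nat \<Rightarrow> nat list \<Rightarrow> nat list \<Rightarrow> nat list list \<Rightarrow> bool" where
  "is_route d n x y r \<longleftrightarrow>
     length r = n \<and> set r \<subseteq> strings d (n - 1) \<and>
     hd r = take (n - 1) x \<and> last r = take (n - 1) y \<and>
     (\<forall>i\<in>{1..n - 1}. link d n i (r ! (i - 1)) (r ! i))"

text \<open>The stage-\<open>j\<close> switching element \<open>y\<^sub>1 \<dots> y\<^sub>j\<^sub>-\<^sub>1 x\<^sub>j \<dots> x\<^sub>n\<^sub>-\<^sub>1\<close> of the route from \<open>x\<close> to \<open>y\<close>.\<close>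

definition route_se :: "nat \<Rightarrow> nat list \<Rightarrow> nat list \<Rightarrow> nat \<Rightarrow> nat list" where
  "route_se n x y j = take (j - 1) y @ drop (j - 1) (take (n - 1) x)"

lemma route_se_in_strings:
  assumes "x \<in> strings d n" "y \<in> strings d n" "1 \<le> j" "j \<le> n"
  shows "route_se n x y j \<in> strings d (n - 1)"
proof -
  have "set (route_se n x y j) \<subseteq> set y \<union> set x"
    unfolding route_se_def by (auto dest: in_set_takeD in_set_dropD)
  moreover have "length (route_se n x y j) = n - 1"
    using assms unfolding route_se_def strings_def by auto
  ultimately show ?thesis using assms unfolding strings_def by auto
qed

lemma route_se_nth:
  assumes "x \<in> strings d n" "y \<in> strings d n" "1 \<le> j" "j \<le> n" "l < n - 1"
  shows "route_se n x y j ! l = (if l < j - 1 then y ! l else x ! l)"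
  using assms unfolding route_se_def strings_def by (auto simp: nth_append min_def)

lemma route_unique:
  assumes n: "1 \<le> n" and x: "x \<in> strings d n" and y: "y \<in> strings d n"
  shows "is_route d n x y r \<longleftrightarrow> r = map (route_se n x y) [1..<n + 1]"
proof
  assume r: "is_route d n x y r"
  have len: "length r = n" and inS: "\<And>s. s < n \<Longrightarrow> length (r ! s) = n - 1"
    using r unfolding is_route_def strings_def by (auto dest: nth_mem)
  have r0: "r ! 0 = take (n - 1) x" and rn: "r ! (n - 1) = take (n - 1) y"
    using r n len unfolding is_route_def
    by (metis hd_conv_nth length_0_conv not_one_le_zero, metis last_conv_nth length_0_conv not_one_le_zero)
  have adj: "r ! s ! l = r ! Suc s ! l" if "Suc s < n" "l < n - 1" "l \<noteq> s" for s l
  proof -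
    have "link d n (Suc s) (r ! s) (r ! Suc s)"
      using r that unfolding is_route_def
      by (metis One_nat_def Suc_le_eq Suc_pred atLeastAtMost_iff diff_Suc_1 le_add1 less_Suc_eq_le n plus_1_eq_Suc)
    then show ?thesis
      using that unfolding link_def
      by (metis One_nat_def Suc_le_eq atLeastAtMost_iff diff_Suc_1 le_add1 nat.inject plus_1_eq_Suc)
  qed
  have early: "r ! s ! l = x ! l" if "s \<le> l" "l < n - 1" for s l
    using that
  proof (induction s)
    case 0 then show ?case using r0 by simp
  next
    case (Suc s)
    have "r ! s ! l = r ! Suc s ! l" using Suc.prems by (intro adj) auto
    then show ?case using Suc by simp
  qed
  have late: "r ! s ! l = y ! l" if "l < s" "s \<le> n - 1" for s l
    using that(2,1)
  proof (induction s rule: inc_induct)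
    case base then show ?case using rn by simp
  next
    case (step s)
    have "r ! s ! l = r ! Suc s ! l" using step.prems step.hyps by (intro adj) auto
    then show ?case using step by simp
  qed
  show "r = map (route_se n x y) [1..<n + 1]"
  proof (rule nth_equalityI)
    show "length r = length (map (route_se n x y) [1..<n + 1])" using len by simp
    fix s assume "s < length r"
    then have s: "s < n" using len by simp
    have "r ! s = route_se n x y (Suc s)"
    proof (rule nth_equalityI)
      show "length (r ! s) = length (route_se n x y (Suc s))"
        using inS[OF s] route_se_in_strings[OF x y, of "Suc s"] s unfolding strings_def by auto
      fix l assume "l < length (r ! s)"
      then have l: "l < n - 1" using inS[OF s] by simp
      show "r ! s ! l = route_se n x y (Suc s) ! l"
        using route_se_nth[OF x y, of "Suc s" l] early[of s l] late[of l s] l s by auto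
    qed
    then show "r ! s = map (route_se n x y) [1..<n + 1] ! s" using s by (simp del: upt_Suc)
  qed
next
  assume r: "r = map (route_se n x y) [1..<n + 1]"
  have nth: "r ! s = route_se n x y (Suc s)" if "s < n" for s
    using that r by (simp del: upt_Suc)
  have len: "length r = n" using r by simp
  have "hd r = take (n - 1) x"
    using nth[of 0] n len by (subst hd_conv_nth) (auto simp: route_se_def)
  moreover have "last r = take (n - 1) y"
    using nth[of "n - 1"] n len x y
    by (subst last_conv_nth) (auto simp: route_se_def strings_def)
  moreover have "set r \<subseteq> strings d (n - 1)"
    using r route_se_in_strings[OF x y] by auto
  moreover have "link d n i (r ! (i - 1)) (r ! i)" if "i \<in> {1..n - 1}" for i
  proof -
    have i: "r ! (i - 1) = route_se n x y i" "r ! i = route_se n x y (Suc i)" "1 \<le> i" "Suc i \<le> n"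
      using that nth[of "i - 1"] nth[of i] by auto
    show ?thesis
      using i route_se_in_strings[OF x y] route_se_nth[OF x y]
      unfolding link_def by auto
  qed
  ultimately show "is_route d n x y r" using len unfolding is_route_def by blast
qed

section \<open>Requests and the window algorithm\<close>

definition windows :: "nat \<Rightarrow> nat \<Rightarrow> nat \<Rightarrow> nat list set set" where
  "windows d n t = (\<lambda>s. {y \<in> strings d n. take (n - t) y = s}) ` strings d (n - t)"

text \<open>A connection \<open>(a, B, pl)\<close> is a request \<open>(a, B)\<close> together with its routing: output
  \<open>b \<in> B\<close> is reached by the route from \<open>a\<close> to \<open>b\<close> on plane \<open>pl b\<close>, where the planes are
  \<open>{..<m}\<close>. Values of \<open>pl\<close> outside \<open>B\<close> are irrelevant.\<close>

type_synonym connection = "nat list \<times> nat list set \<times> (nat list \<Rightarrow> nat)"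

text \<open>Switching elements of \<open>log\<^sub>d(N, 0, m)\<close> are triples (plane, stage, label).\<close>

fun used_ses :: "nat \<Rightarrow> connection \<Rightarrow> (nat \<times> nat \<times> nat list) set" where
  "used_ses n (a, B, pl) = {(pl b, j, route_se n a b j) | b j. b \<in> B \<and> 1 \<le> j \<and> j \<le> n}"

definition follows_window_rule :: "nat \<Rightarrow> nat \<Rightarrow> nat \<Rightarrow> nat \<Rightarrow> connection \<Rightarrow> bool" where
  "follows_window_rule d n m t c \<longleftrightarrow>
     (case c of (a, B, pl) \<Rightarrow> \<forall>X\<in>windows d n t. \<exists>l<m. \<forall>b\<in>B \<inter> X. pl b = l)"

definition is_new_request ::
    "nat \<Rightarrow> nat \<Rightarrow> nat \<Rightarrow> connection set \<Rightarrow> nat list \<Rightarrow> nat list set \<Rightarrow> bool" where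
  "is_new_request d n f S a B \<longleftrightarrow>
     a \<in> strings d n \<and> B \<subseteq> strings d n \<and> B \<noteq> {} \<and> card B \<le> f \<and>
     (\<forall>(a', B', pl')\<in>S. a \<noteq> a' \<and> B \<inter> B' = {})"

definition can_route :: "nat \<Rightarrow> nat \<Rightarrow> nat \<Rightarrow> nat \<Rightarrow> connection set \<Rightarrow> connection \<Rightarrow> bool" where
  "can_route d n m t S c \<longleftrightarrow>
     follows_window_rule d n m t c \<and> (\<forall>c'\<in>S. used_ses n c \<inter> used_ses n c' = {})"

text \<open>The network states that can arise when requests arrive and depart in arbitrary order.\<close>

inductive reachable :: "nat \<Rightarrow> nat \<Rightarrow> nat \<Rightarrow> nat \<Rightarrow> nat \<Rightarrow> connection set \<Rightarrow> bool"
  for d n m t f :: nat where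
  empty: "reachable d n m t f {}"
| arrive: "reachable d n m t f S \<Longrightarrow> is_new_request d n f S a B \<Longrightarrow>
    can_route d n m t S (a, B, pl) \<Longrightarrow> reachable d n m t f (insert (a, B, pl) S)"
| depart: "reachable d n m t f S \<Longrightarrow> c \<in> S \<Longrightarrow> reachable d n m t f (S - {c})"

definition window_nonblocking :: "nat \<Rightarrow> nat \<Rightarrow> nat \<Rightarrow> nat \<Rightarrow> nat \<Rightarrow> bool" where
  "window_nonblocking d n m t f \<longleftrightarrow>
     (\<forall>S a B. reachable d n m t f S \<and> is_new_request d n f S a B \<longrightarrow>
       (\<exists>pl. can_route d n m t S (a, B, pl)))"

section \<open>The linear program\<close>

definition lcp_length :: "nat list \<Rightarrow> nat list \<Rightarrow> nat" where
  "lcp_length xs ys = length (longest_common_prefix xs ys)"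

definition lcs_length :: "nat list \<Rightarrow> nat list \<Rightarrow> nat" where
  "lcs_length xs ys = lcp_length (rev xs) (rev ys)"

definition A_set :: "nat \<Rightarrow> nat \<Rightarrow> nat list \<Rightarrow> nat \<Rightarrow> nat list set" where
  "A_set d n a i =
     {u \<in> strings d n. u \<noteq> a \<and> lcs_length (take (n - 1) u) (take (n - 1) a) = i}"

definition A_all :: "nat \<Rightarrow> nat \<Rightarrow> nat list \<Rightarrow> nat list set" where
  "A_all d n a = (\<Union>i\<in>{0..n - 1}. A_set d n a i)"

definition i_of :: "nat \<Rightarrow> nat \<Rightarrow> nat list \<Rightarrow> nat list \<Rightarrow> nat" where
  "i_of d n a u = (THE i. i \<in> {0..n - 1} \<and> u \<in> A_set d n a i)"

text \<open>Distinct sets \<open>B_set d n B j\<close> may overlap, since different elements of \<open>B\<close> may have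
  different common prefixes with the same output.\<close>

definition B_set :: "nat \<Rightarrow> nat \<Rightarrow> nat list set \<Rightarrow> nat \<Rightarrow> nat list set" where
  "B_set d n B j =
     {v \<in> strings d n. v \<notin> B \<and> (\<exists>b\<in>B. lcp_length (take (n - 1) v) (take (n - 1) b) = j)}"

text \<open>In the following, \<open>W\<close> enumerates the windows as \<open>W 0, \<dots>, W (d ^ (n - t) - 1)\<close>.\<close>

definition j_win :: "nat \<Rightarrow> nat \<Rightarrow> (nat \<Rightarrow> nat list set) \<Rightarrow> nat list set \<Rightarrow> nat \<Rightarrow> nat" where
  "j_win d n W B w = (THE j. j \<in> {0..n - 1} \<and> W w \<subseteq> B_set d n B j)"

definition j_out :: "nat \<Rightarrow> nat \<Rightarrow> nat list set \<Rightarrow> nat list \<Rightarrow> nat" where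
  "j_out d n B v = Max {j \<in> {0..n - 1}. v \<in> B_set d n B j}"

definition win_idx :: "nat \<Rightarrow> nat \<Rightarrow> nat \<Rightarrow> nat set" where
  "win_idx d n t = {1..d ^ (n - t) - 1}"

definition beta_idx :: "nat \<Rightarrow> nat \<Rightarrow> nat \<Rightarrow> (nat \<Rightarrow> nat list set) \<Rightarrow> nat list \<Rightarrow> nat list set \<Rightarrow>
    (nat list \<times> nat) set" where
  "beta_idx d n t W a B =
     {(u, w). u \<in> A_all d n a \<and> w \<in> win_idx d n t \<and> n - 1 \<le> i_of d n a u + j_win d n W B w}"

text \<open>An assignment of values to the variables of the linear program. Only the values at the
  index sets of the respective variables matter.\<close>

record lp_vars =
  alpha :: "nat \<Rightarrow> real"
  beta :: "nat list \<Rightarrow> nat \<Rightarrow> real"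
  gamma :: "nat list \<Rightarrow> real"
  delta :: "nat list \<Rightarrow> real"
  eps :: "nat list \<Rightarrow> real"

definition lp_feasible :: "nat \<Rightarrow> nat \<Rightarrow> nat \<Rightarrow> (nat \<Rightarrow> nat list set) \<Rightarrow> nat list \<Rightarrow> nat list set \<Rightarrow>
    lp_vars \<Rightarrow> bool" where
  "lp_feasible d n t W a B s \<longleftrightarrow>
     (\<forall>w\<in>win_idx d n t. 0 \<le> alpha s w) \<and>
     (\<forall>(u, w)\<in>beta_idx d n t W a B. 0 \<le> beta s u w) \<and>
     (\<forall>u\<in>A_all d n a. 0 \<le> gamma s u \<and> 0 \<le> eps s u) \<and>
     (\<forall>v\<in>W 0 - B. 0 \<le> delta s v) \<and>
     (\<forall>(u, w)\<in>beta_idx d n t W a B. 1 \<le> alpha s w + beta s u w + eps s u) \<and>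
     (\<forall>u\<in>A_all d n a. \<forall>v\<in>W 0 - B. n - 1 \<le> i_of d n a u + j_out d n B v \<longrightarrow>
        1 \<le> gamma s u + delta s v + eps s u)"

definition lp_objective :: "nat \<Rightarrow> nat \<Rightarrow> nat \<Rightarrow> nat \<Rightarrow> (nat \<Rightarrow> nat list set) \<Rightarrow> nat list \<Rightarrow>
    nat list set \<Rightarrow> lp_vars \<Rightarrow> real" where
  "lp_objective d n t f W a B s =
     (\<Sum>w\<in>win_idx d n t. real d ^ t * alpha s w) +
     (\<Sum>(u, w)\<in>beta_idx d n t W a B. beta s u w) +
     (\<Sum>u\<in>A_all d n a. gamma s u) +
     (\<Sum>v\<in>W 0 - B. delta s v) +
     (\<Sum>u\<in>A_all d n a. real f * eps s u)"

definition S_pq :: "nat \<Rightarrow> nat \<Rightarrow> nat \<Rightarrow> (nat \<Rightarrow> nat list set) \<Rightarrow> nat list \<Rightarrow> nat list set \<Rightarrow>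
    nat \<Rightarrow> nat \<Rightarrow> lp_vars" where
  "S_pq d n t W a B p q =
     \<lparr>alpha = (\<lambda>w. of_bool (
        if \<lceil>real n / 2\<rceil> \<le> int t then False
        else if p + 1 \<le> t then t \<le> j_win d n W B w \<and> j_win d n W B w \<le> n - t - 1
        else p \<le> j_win d n W B w \<and> j_win d n W B w \<le> n - t - 1)),
      beta = (\<lambda>u w. of_bool (
        n - 1 - j_win d n W B w \<le> i_of d n a u \<and> i_of d n a u \<le> n - p - 1 \<and>
        (if \<lceil>real n / 2\<rceil> \<le> int t then p \<le> j_win d n W B w \<and> j_win d n W B w \<le> n - t - 1
         else if p + 1 \<le> t then p \<le> j_win d n W B w \<and> j_win d n W B w \<le> t - 1
         else False))),
      gamma = (\<lambda>u. of_bool (n - t + 1 \<le> q \<and> n - q \<le> i_of d n a u \<and> i_of d n a u \<le> n - p - 1)),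
      delta = (\<lambda>v. of_bool (
        if q = n - t then v \<in> W 0 - B else v \<in> (\<Union>j\<in>{q..n - 1}. B_set d n B j))),
      eps = (\<lambda>u. of_bool (n - p \<le> i_of d n a u))\<rparr>"

section \<open>The bound\<close>

text \<open>For \<open>q > n - t\<close>, \<open>mu d n t k q\<close> is the largest possible number of outputs in
  \<open>\<Union>j\<in>{q..n - 1}. B_set d n B j\<close> for \<open>B \<subseteq> W 0\<close> with \<open>card B = k\<close>. Sets \<open>B\<close> whose elements share
  prefixes of length \<open>q\<close> have fewer such outputs, and the objective value of \<open>S_pq\<close> is smaller by
  exactly that difference.\<close>

definition mu :: "nat \<Rightarrow> nat \<Rightarrow> nat \<Rightarrow> nat \<Rightarrow> nat \<Rightarrow> int" where
  "mu d n t k q = min (int d ^ t - int k) (int k * (int d ^ (n - q) - 1))"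

definition g :: "nat \<Rightarrow> nat \<Rightarrow> nat \<Rightarrow> nat \<Rightarrow> nat \<Rightarrow> nat \<Rightarrow> nat \<Rightarrow> int" where
  "g d n t f k p q =
     (let D = int d; F = int f * (D ^ p - 1); K = int k; M = mu d n t k q in
      if \<lceil>real n / 2\<rceil> \<le> int t then
        (if q = n - t
         then F + int (n - t - p) * (D ^ (n - t + 1) - D ^ (n - t)) - D ^ (n - t) + D ^ p + D ^ t - K
         else F + int (n - t - p) * (D ^ (n - t + 1) - D ^ (n - t)) - D ^ (n - t) + D ^ q + M)
      else if p + 1 \<le> t then
        (if q = n - t
         then F + int (t - p) * (D ^ (n - t + 1) - D ^ (n - t)) + D ^ (n + p - 2 * t) - K
         else F + int (t - p) * (D ^ (n - t + 1) - D ^ (n - t)) + D ^ (n + p - 2 * t)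
                - D ^ t + D ^ q - D ^ p + M)
      else
        (if q = n - t
         then F + D ^ (n - p) - K
         else F + D ^ (n - p) - D ^ t + D ^ q - D ^ p + M))"

end

theory Submission
  imports Defs
begin

text \<open>The routes of \<open>a \<rightarrow> b\<close> and \<open>u \<rightarrow> v\<close> share a switching element iff the common suffix of the inputs without their last letters
  and the common prefix of the outputs have total length at least \<open>n - 1\<close>. Choose for every plane that
  is unavailable to the part of a new request in one window an existing route \<open>u \<rightarrow> v\<close> that blocks it.
  Summing the constraints of (D) at these pairs bounds the number of blocked planes by the objective of
  any feasible point: \<open>\<alpha>\<^sub>w\<close> is counted at most once per output of window \<open>w\<close>, \<open>\<beta>\<^sub>u\<^sub>,\<^sub>w\<close> and \<open>\<gamma>\<^sub>u\<close> at most
  once by the window rule, \<open>\<delta>\<^sub>v\<close> once per output, and \<open>\<epsilon>\<^sub>u\<close> at most \<open>f\<close> times by the fanout bound.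
  The objective of \<open>S_pq\<close> only involves the numbers \<open>d\<^sup>n\<^sup>-\<^sup>l - 1\<close> of inputs \<open>u\<close> with \<open>i(u) \<ge> l\<close> and
  \<open>d\<^sup>n\<^sup>-\<^sup>t\<^sup>-\<^sup>j - 1\<close> of windows \<open>w\<close> with \<open>j(w) \<ge> j\<close>, and the number of outputs outside \<open>B\<close> that share a
  prefix of length \<open>q\<close> with \<open>B\<close>.\<close>

section \<open>Strings with common prefixes and suffixes\<close>

text \<open>Comparing the length with thresholds \<open>i\<close> replaces
  \<open>longest_common_prefix\<close> by equations between \<open>take\<close>s; all later
  arguments on common prefixes use this form.\<close>

lemma le_lcp_length_iff:
  "i \<le> lcp_length xs ys \<longleftrightarrow> i \<le> length xs \<and> i \<le> length ys \<and> take i xs = take i ys"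
proof
  let ?p = "longest_common_prefix xs ys"
  assume i: "i \<le> lcp_length xs ys"
  obtain us vs where eq: "xs = ?p @ us" "ys = ?p @ vs"
    using longest_common_prefix_prefix1 longest_common_prefix_prefix2 prefixE by metis
  have len: "i \<le> length ?p" using i by (simp add: lcp_length_def)
  have "take i xs = take i ?p" "take i ys = take i ?p"
    by (subst eq(1), use len in simp) (subst eq(2), use len in simp)
  moreover have "length ?p \<le> length xs" "length ?p \<le> length ys"
    by (subst (2) eq(1), simp) (subst (2) eq(2), simp)
  ultimately show "i \<le> length xs \<and> i \<le> length ys \<and> take i xs = take i ys"
    using len by simp
next
  assume i: "i \<le> length xs \<and> i \<le> length ys \<and> take i xs = take i ys"
  then have "prefix (take i xs) (longest_common_prefix xs ys)"
    by (metis longest_common_prefix_max_prefix take_is_prefix)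
  from prefix_length_le[OF this] show "i \<le> lcp_length xs ys"
    using i by (simp add: lcp_length_def)
qed

lemma le_lcs_length_iff:
  assumes "length xs = length ys"
  shows "i \<le> lcs_length xs ys \<longleftrightarrow>
    i \<le> length xs \<and> drop (length xs - i) xs = drop (length xs - i) ys"
  using assms by (auto simp: lcs_length_def le_lcp_length_iff take_rev)

lemma lcp_length_less:
  assumes "length xs = l" "length ys = l" "xs \<noteq> ys"
  shows "lcp_length xs ys < l"
  using assms le_lcp_length_iff[of l xs ys] by (auto simp: not_le[symmetric])

lemma lcp_length_take: "lcp_length (take l xs) (take l ys) = min l (lcp_length xs ys)"
proof -
  have "i \<le> lcp_length (take l xs) (take l ys) \<longleftrightarrow> i \<le> min l (lcp_length xs ys)" for i
    unfolding le_lcp_length_iff min.bounded_iff by (auto simp: min_def split: if_splits)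
  then show ?thesis by (meson antisym order_refl)
qed

text \<open>Distinct strings of length \<open>n\<close> agree in at most \<open>n - 1\<close>
  leading letters, so cutting off the last letter loses nothing. This passes from switching-element
  labels to whole outputs.\<close>

lemma lcp_length_butlast:
  assumes "x \<in> strings d n" "y \<in> strings d n" "x \<noteq> y"
  shows "lcp_length (take (n - 1) x) (take (n - 1) y) = lcp_length x y"
  using lcp_length_less[of x n y] assms by (auto simp: lcp_length_take strings_def)

section \<open>Counting strings with a prescribed prefix or suffix\<close>

lemma finite_strings [simp]: "finite (strings d n)"
  unfolding strings_def by (rule finite_lists_length_eq) simp

lemma card_strings [simp]: "card (strings d n) = d ^ n"
  unfolding strings_def by (subst card_lists_length_eq) auto

lemma take_strings: "x \<in> strings d n \<Longrightarrow> i \<le> n \<Longrightarrow> take i x \<in> strings d i"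
  by (auto simp: strings_def dest: in_set_takeD)

lemma drop_strings: "x \<in> strings d n \<Longrightarrow> drop i x \<in> strings d (n - i)"
  by (auto simp: strings_def dest: in_set_dropD)

lemma append_strings: "x \<in> strings d i \<Longrightarrow> y \<in> strings d j \<Longrightarrow> x @ y \<in> strings d (i + j)"
  by (auto simp: strings_def)

text \<open>The fixed block lengths make the decomposition unique. The prefix count takes the left
  block empty, the suffix count takes a right block of one letter.\<close>

lemma card_strings_infix:
  "card ((\<lambda>(x, y). x @ s @ y) ` (strings d i \<times> strings d j)) = d ^ (i + j)"
proof -
  have "inj_on (\<lambda>(x, y). x @ s @ y) (strings d i \<times> strings d j)"
    by (auto simp: inj_on_def strings_def)
  then show ?thesis by (simp add: card_image card_cartesian_product power_add)
qed

lemma card_strings_prefix: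
  assumes "s \<in> strings d q" "q \<le> n"
  shows "card {v \<in> strings d n. take q v = s} = d ^ (n - q)"
proof -
  have "{v \<in> strings d n. take q v = s} = (\<lambda>(x, y). x @ s @ y) ` (strings d 0 \<times> strings d (n - q))"
  proof (intro equalityI subsetI)
    fix v assume v: "v \<in> {v \<in> strings d n. take q v = s}"
    then have "v = s @ drop q v" by (metis (mono_tags, lifting) append_take_drop_id mem_Collect_eq)
    moreover have "drop q v \<in> strings d (n - q)" using v drop_strings by blast
    ultimately show "v \<in> (\<lambda>(x, y). x @ s @ y) ` (strings d 0 \<times> strings d (n - q))"
      by (intro image_eqI[of _ _ "([], drop q v)"]) (auto simp: strings_def)
  qed (use assms in \<open>auto simp: strings_def\<close>)
  then show ?thesis by (simp add: card_strings_infix)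
qed

text \<open>Free are the first \<open>n - 1 - l\<close> letters and also the last letter of
  \<open>u\<close>, which does not belong to its switching-element label.\<close>

lemma card_strings_suffix:
  assumes a: "a \<in> strings d n" and l: "l < n"
  shows "card {u \<in> strings d n. drop (n - 1 - l) (take (n - 1) u) = drop (n - 1 - l) (take (n - 1) a)}
    = d ^ (n - l)"
proof -
  define s where "s = drop (n - 1 - l) (take (n - 1) a)"
  have s: "s \<in> strings d l"
    using drop_strings[OF take_strings[OF a, of "n - 1"], of "n - 1 - l"] l by (simp add: s_def)
  have "{u \<in> strings d n. drop (n - 1 - l) (take (n - 1) u) = s}
    = (\<lambda>(x, y). x @ s @ y) ` (strings d (n - 1 - l) \<times> strings d 1)"
  proof (intro equalityI subsetI)
    fix u assume u: "u \<in> {u \<in> strings d n. drop (n - 1 - l) (take (n - 1) u) = s}"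
    then have us: "u \<in> strings d n" and eq: "drop (n - 1 - l) (take (n - 1) u) = s" by auto
    have "u = take (n - 1) u @ drop (n - 1) u" by simp
    also have "take (n - 1) u = take (n - 1 - l) (take (n - 1) u) @ s"
      unfolding eq[symmetric] by (rule append_take_drop_id[symmetric])
    finally have "u = take (n - 1 - l) u @ s @ drop (n - 1) u"
      by (simp add: min_absorb1 diff_le_mono2)
    moreover have "take (n - 1 - l) u \<in> strings d (n - 1 - l)" "drop (n - 1) u \<in> strings d 1"
      using take_strings[OF us, of "n - 1 - l"] drop_strings[OF us, of "n - 1"] l by auto
    ultimately show "u \<in> (\<lambda>(x, y). x @ s @ y) ` (strings d (n - 1 - l) \<times> strings d 1)"
      by (intro image_eqI[of _ _ "(take (n - 1 - l) u, drop (n - 1) u)"]) auto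
  qed (use s l in \<open>auto simp: strings_def\<close>)
  moreover have "n - 1 - l + 1 = n - l" using l by simp
  ultimately show ?thesis
    using card_strings_infix[of s d "n - 1 - l" 1] unfolding s_def by presburger
qed

section \<open>Base-\<open>d\<close> digits\<close>

fun digits :: "nat \<Rightarrow> nat \<Rightarrow> nat \<Rightarrow> nat list" where
  "digits d 0 x = []"
| "digits d (Suc r) x = (x mod d) # digits d r (x div d)"

lemma digits_strings: "0 < d \<Longrightarrow> digits d r x \<in> strings d r"
  by (induction r arbitrary: x) (auto simp: strings_def)

text \<open>With the least significant digit first, cutting an expansion forgets its high digits, so
  a prefix of length \<open>q\<close> depends only on \<open>x\<close> modulo
  \<open>d ^ q\<close>.\<close>

lemma take_digits: "q \<le> r \<Longrightarrow> take q (digits d r x) = digits d q x"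
proof (induction q arbitrary: r x)
  case (Suc q)
  then show ?case by (cases r) auto
qed simp

lemma inj_on_digits:
  assumes "0 < d"
  shows "inj_on (digits d r) {..<d ^ r}"
proof (rule inj_onI)
  fix x y assume "x \<in> {..<d ^ r}" "y \<in> {..<d ^ r}" "digits d r x = digits d r y"
  then show "x = y"
  proof (induction r arbitrary: x y)
    case (Suc r)
    then have "x div d = y div d" "x mod d = y mod d"
      by (auto simp: less_mult_imp_div_less mult.commute intro!: Suc.IH)
    then show ?case by (metis div_mult_mod_eq)
  qed auto
qed

text \<open>The first \<open>d ^ r\<close> numbers already exhaust \<open>strings d r\<close>
  without repetition; further ones add nothing.\<close>

lemma card_digits_image:
  assumes "0 < d"
  shows "card (digits d r ` {..<k}) = min (d ^ r) k"
proof (cases "k \<le> d ^ r")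
  case True
  then have "inj_on (digits d r) {..<k}"
    by (intro inj_on_subset[OF inj_on_digits[OF assms, of r]]) auto
  then show ?thesis using True by (simp add: card_image)
next
  case False
  have "digits d r ` {..<d ^ r} \<subseteq> digits d r ` {..<k}" using False by auto
  from card_mono[OF _ this] have "d ^ r \<le> card (digits d r ` {..<k})"
    using inj_on_digits[OF assms] by (simp add: card_image)
  moreover have "digits d r ` {..<k} \<subseteq> strings d r" using digits_strings[OF assms] by auto
  from card_mono[OF _ this] have "card (digits d r ` {..<k}) \<le> d ^ r" by simp
  ultimately show ?thesis using False by simp
qed

section \<open>The linear program at a fixed request\<close>

text \<open>Grouping by \<open>h l\<close> counts each weight once per element of its fibre. In the
  weak duality argument \<open>L\<close> indexes blocking routes and \<open>wt\<close> is one family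
  of variables of (D).\<close>

lemma sum_le_fibres:
  fixes wt :: "'b \<Rightarrow> real"
  assumes "finite L" "finite I" "h ` L \<subseteq> I"
    and c: "\<And>i. i \<in> I \<Longrightarrow> card {l \<in> L. h l = i} \<le> c"
    and wt: "\<And>i. i \<in> I \<Longrightarrow> 0 \<le> wt i"
  shows "(\<Sum>l\<in>L. wt (h l)) \<le> (\<Sum>i\<in>I. real c * wt i)"
proof -
  have "(\<Sum>l\<in>L. wt (h l)) = (\<Sum>i\<in>I. \<Sum>l | l \<in> L \<and> h l = i. wt (h l))"
    using assms by (intro sum.group[symmetric]) auto
  also have "\<dots> = (\<Sum>i\<in>I. real (card {l \<in> L. h l = i}) * wt i)" by simp
  also have "\<dots> \<le> (\<Sum>i\<in>I. real c * wt i)"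
    using c wt by (intro sum_mono mult_right_mono) auto
  finally show ?thesis .
qed

lemma card_fibre_inj:
  assumes "\<And>l l'. l \<in> L \<Longrightarrow> l' \<in> L \<Longrightarrow> h l = h l' \<Longrightarrow> l = l'"
  shows "card {l \<in> L. h l = i} \<le> 1"
proof (cases "{l \<in> L. h l = i} = {}")
  case False
  then obtain l where "l \<in> L" "h l = i" by auto
  then have "{l' \<in> L. h l' = i} \<subseteq> {l}" using assms by auto
  from card_mono[OF _ this] show ?thesis by simp
qed (metis card.empty zero_le)

lemma sum_of_bool_card:
  "finite A \<Longrightarrow> (\<Sum>x\<in>A. of_bool (P x)) = real (card {x \<in> A. P x})"
  by (simp add: Int_def)

section \<open>Windows and their prefixes\<close>

locale window_enum =
  fixes d n t :: nat and W :: "nat \<Rightarrow> nat list set"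
  assumes d: "2 \<le> d" and t: "t < n"
    and W: "bij_betw W {0..d ^ (n - t) - 1} (windows d n t)"
begin

text \<open>Windows are given as sets, so the prefix shared by the outputs of \<open>W w\<close> is
  recovered by choice; it is meaningful only for \<open>w \<le> d ^ (n - t) - 1\<close>.\<close>

definition wpre :: "nat \<Rightarrow> nat list" where
  "wpre w = (SOME s. s \<in> strings d (n - t) \<and> W w = {y \<in> strings d n. take (n - t) y = s})"

lemma win_idx_insert: "insert 0 (win_idx d n t) = {0..d ^ (n - t) - 1}"
  by (auto simp: win_idx_def)

lemma finite_win_idx [simp]: "finite (win_idx d n t)"
  by (simp add: win_idx_def)

lemma wpre:
  assumes "w \<le> d ^ (n - t) - 1"
  shows "wpre w \<in> strings d (n - t)" "W w = {y \<in> strings d n. take (n - t) y = wpre w}"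
proof -
  have "W w \<in> windows d n t" using W assms by (auto simp: bij_betw_def)
  then have "\<exists>s. s \<in> strings d (n - t) \<and> W w = {y \<in> strings d n. take (n - t) y = s}"
    by (auto simp: windows_def)
  from someI_ex[OF this]
  show "wpre w \<in> strings d (n - t)" "W w = {y \<in> strings d n. take (n - t) y = wpre w}"
    by (auto simp: wpre_def)
qed

text \<open>\<open>wpre\<close> determines the window, hence is injective because \<open>W\<close>
  is; equal cardinalities make it onto.\<close>

lemma wpre_bij: "bij_betw wpre {0..d ^ (n - t) - 1} (strings d (n - t))"
proof -
  let ?I = "{0..d ^ (n - t) - 1}"
  have inj: "inj_on wpre ?I"
  proof (rule inj_onI)
    fix w w' assume *: "w \<in> ?I" "w' \<in> ?I" "wpre w = wpre w'"
    then have "W w = W w'" using wpre(2)[of w] wpre(2)[of w'] by simp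
    then show "w = w'" using W * by (auto simp: bij_betw_def inj_on_def)
  qed
  moreover have "wpre ` ?I \<subseteq> strings d (n - t)" using wpre by auto
  moreover have "card (wpre ` ?I) = card (strings d (n - t))"
    using inj d by (simp add: card_image)
  ultimately show ?thesis by (auto simp: bij_betw_def card_subset_eq)
qed

lemma W0: "W 0 = {y \<in> strings d n. take (n - t) y = wpre 0}"
  by (rule wpre) simp

lemma card_W: "w \<le> d ^ (n - t) - 1 \<Longrightarrow> card (W w) = d ^ t"
  using wpre[of w] card_strings_prefix[of "wpre w" d "n - t" n] t by simp

lemma finite_W: "w \<le> d ^ (n - t) - 1 \<Longrightarrow> finite (W w)"
  using wpre[of w] by simp

lemma wpre_neq: "w \<in> win_idx d n t \<Longrightarrow> wpre w \<noteq> wpre 0"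
  using wpre_bij inj_onD[of wpre "{0..d ^ (n - t) - 1}" w 0]
  by (auto simp: bij_betw_def win_idx_def)

lemma lcp_wpre_less: "w \<in> win_idx d n t \<Longrightarrow> lcp_length (wpre w) (wpre 0) < n - t"
  using wpre(1)[of w] wpre(1)[of 0] wpre_neq[of w]
  by (intro lcp_length_less) (auto simp: strings_def win_idx_def)

text \<open>The prefixes of length \<open>n - t\<close> already differ, so the common length does
  not depend on the choice of \<open>v\<close> and \<open>b\<close>. This makes \<open>j_win\<close>
  well defined.\<close>

lemma lcp_other_window:
  assumes w: "w \<in> win_idx d n t" and v: "v \<in> W w" and b: "b \<in> W 0"
  shows "lcp_length v b = lcp_length (wpre w) (wpre 0)" "v \<noteq> b"
proof -
  have w': "w \<le> d ^ (n - t) - 1" using w by (auto simp: win_idx_def)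
  have *: "take (n - t) v = wpre w" "take (n - t) b = wpre 0"
    using v b wpre(2)[OF w'] W0 by auto
  show "lcp_length v b = lcp_length (wpre w) (wpre 0)"
    using lcp_length_take[of "n - t" v b] * lcp_wpre_less[OF w] by (auto simp: min_def split: if_splits)
  show "v \<noteq> b" using * wpre_neq[OF w] by auto
qed

end

section \<open>Levels of inputs and windows\<close>

locale window_lp = window_enum +
  fixes a :: "nat list" and B :: "nat list set"
  assumes a: "a \<in> strings d n" and B: "B \<subseteq> W 0" "B \<noteq> {}"
begin

lemma B_strings: "B \<subseteq> strings d n"
  using B W0 by auto

lemma finite_B [simp]: "finite B"
  using B_strings finite_strings finite_subset by blast

lemma card_B_le: "card B \<le> d ^ t"
  using card_mono[OF finite_W B(1)] card_W[of 0] by simp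

lemma mem_B_set_iff:
  "v \<in> B_set d n B j \<longleftrightarrow> v \<in> strings d n \<and> v \<notin> B \<and> (\<exists>b\<in>B. lcp_length v b = j)"
proof -
  have "lcp_length (take (n - 1) v) (take (n - 1) b) = lcp_length v b"
    if "v \<in> strings d n" "v \<notin> B" "b \<in> B" for b
    using that B_strings by (intro lcp_length_butlast) auto
  then show ?thesis by (auto simp: B_set_def)
qed

lemma j_win_eq:
  assumes w: "w \<in> win_idx d n t"
  shows "j_win d n W B w = lcp_length (wpre w) (wpre 0)"
  unfolding j_win_def
proof (rule the_equality)
  have w': "w \<le> d ^ (n - t) - 1" using w by (auto simp: win_idx_def)
  have "W w \<subseteq> B_set d n B (lcp_length (wpre w) (wpre 0))"
  proof
    fix v assume v: "v \<in> W w"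
    then have "v \<in> strings d n" using wpre(2)[OF w'] by auto
    then show "v \<in> B_set d n B (lcp_length (wpre w) (wpre 0))"
      unfolding mem_B_set_iff using lcp_other_window[OF w v] B by blast
  qed
  then show "lcp_length (wpre w) (wpre 0) \<in> {0..n - 1} \<and>
    W w \<subseteq> B_set d n B (lcp_length (wpre w) (wpre 0))"
    using lcp_wpre_less[OF w] by auto
  fix j assume j: "j \<in> {0..n - 1} \<and> W w \<subseteq> B_set d n B j"
  \<comment> \<open>Uniqueness in the definite description is tested on an output of the window, so
    one has to exist.\<close>
  have "W w \<noteq> {}" using card_W[OF w'] d by auto
  then obtain v where v: "v \<in> W w" by auto
  with j obtain b where "b \<in> B" "lcp_length v b = j" unfolding subset_eq mem_B_set_iff by blast
  then show "j = lcp_length (wpre w) (wpre 0)" using lcp_other_window[OF w v] B by auto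
qed

lemma j_win_less: "w \<in> win_idx d n t \<Longrightarrow> j_win d n W B w < n - t"
  by (simp add: j_win_eq lcp_wpre_less)

text \<open>Window \<open>0\<close> shares every prefix with itself. Once it is added, the windows
  counted are those whose prefix agrees with \<open>wpre 0\<close> in the first \<open>j\<close>
  letters; the \<open>- 1\<close> takes it out again.\<close>

lemma card_j_win_ge:
  assumes j: "j \<le> n - t"
  shows "int (card {w \<in> win_idx d n t. j \<le> j_win d n W B w}) = int d ^ (n - t - j) - 1"
proof -
  let ?T = "{w \<in> win_idx d n t. j \<le> j_win d n W B w}"
  have len: "length (wpre w) = n - t" if "w \<in> {0..d ^ (n - t) - 1}" for w
    using wpre(1)[of w] that by (auto simp: strings_def)
  have eq: "insert 0 ?T = {w \<in> {0..d ^ (n - t) - 1}. take j (wpre w) = take j (wpre 0)}"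
    unfolding win_idx_insert[symmetric]
    using len j by (auto simp: j_win_eq le_lcp_length_iff win_idx_def)
  have "wpre ` {w \<in> {0..d ^ (n - t) - 1}. take j (wpre w) = take j (wpre 0)}
    = {s \<in> strings d (n - t). take j s = take j (wpre 0)}"
    using bij_betw_imp_surj_on[OF wpre_bij, symmetric] by auto
  moreover have "inj_on wpre {w \<in> {0..d ^ (n - t) - 1}. take j (wpre w) = take j (wpre 0)}"
    using wpre_bij unfolding bij_betw_def by (auto intro: inj_on_subset)
  ultimately have "card (insert 0 ?T) = card {s \<in> strings d (n - t). take j s = take j (wpre 0)}"
    unfolding eq by (metis (no_types, lifting) card_image)
  also have "\<dots> = d ^ (n - t - j)"
    using j by (intro card_strings_prefix take_strings[OF wpre(1)]) auto
  finally have "card (insert 0 ?T) = d ^ (n - t - j)" .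
  moreover have "card (insert 0 ?T) = Suc (card ?T)"
    by (rule card_insert_disjoint) (auto simp: win_idx_def)
  ultimately have "int (Suc (card ?T)) = int (d ^ (n - t - j))" by simp
  then show ?thesis by simp
qed

lemma lcs_less: "lcs_length (take (n - 1) u) (take (n - 1) a) < n" if "u \<in> strings d n"
  using that a t le_lcs_length_iff[of "take (n - 1) u" "take (n - 1) a"
      "lcs_length (take (n - 1) u) (take (n - 1) a)"]
  by (auto simp: strings_def)

lemma A_all_eq: "A_all d n a = strings d n - {a}"
  using lcs_less t by (fastforce simp: A_all_def A_set_def)

lemma finite_A_all [simp]: "finite (A_all d n a)"
  by (simp add: A_all_eq)

lemma i_of_eq:
  assumes "u \<in> A_all d n a"
  shows "i_of d n a u = lcs_length (take (n - 1) u) (take (n - 1) a)"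
  unfolding i_of_def using assms lcs_less[of u]
  by (intro the_equality) (auto simp: A_all_eq A_set_def)

lemma i_of_less: "u \<in> A_all d n a \<Longrightarrow> i_of d n a u < n"
  using lcs_less by (auto simp: i_of_eq A_all_eq)

text \<open>As for windows, \<open>a\<close> is added and removed again. The case
  \<open>l = n\<close> is separate because labels have only \<open>n - 1\<close> letters; there both
  sides vanish.\<close>

lemma card_i_of_ge:
  assumes l: "l \<le> n"
  shows "int (card {u \<in> A_all d n a. l \<le> i_of d n a u}) = int d ^ (n - l) - 1"
proof (cases "l = n")
  case True
  then have "{u \<in> A_all d n a. l \<le> i_of d n a u} = {}" using i_of_less by fastforce
  then show ?thesis using True by simp
next
  case False
  let ?T = "{u \<in> A_all d n a. l \<le> i_of d n a u}"
  have eq: "insert a ?T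
    = {u \<in> strings d n. drop (n - 1 - l) (take (n - 1) u) = drop (n - 1 - l) (take (n - 1) a)}"
    (is "_ = ?R")
  proof -
    have "l \<le> i_of d n a u \<longleftrightarrow> drop (n - 1 - l) (take (n - 1) u) = drop (n - 1 - l) (take (n - 1) a)"
      if "u \<in> A_all d n a" for u
      using that False l a unfolding i_of_eq[OF that]
      by (subst le_lcs_length_iff) (auto simp: A_all_eq strings_def min_def)
    then show ?thesis using a by (auto simp: A_all_eq)
  qed
  have "card (insert a ?T) = d ^ (n - l)"
    unfolding eq using False l by (intro card_strings_suffix[OF a]) simp
  moreover have "card (insert a ?T) = Suc (card ?T)"
    by (rule card_insert_disjoint) (auto simp: A_all_eq)
  ultimately have "int (Suc (card ?T)) = int (d ^ (n - l))" by simp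
  then show ?thesis by simp
qed

lemma card_i_of_between:
  assumes "l \<le> l'" "l' \<le> n"
  shows "int (card {u \<in> A_all d n a. l \<le> i_of d n a u \<and> i_of d n a u < l'})
    = int d ^ (n - l) - int d ^ (n - l')"
proof -
  let ?T = "\<lambda>l. {u \<in> A_all d n a. l \<le> i_of d n a u}"
  have "card (?T l) = card {u \<in> A_all d n a. l \<le> i_of d n a u \<and> i_of d n a u < l'} + card (?T l')"
    using assms by (subst card_Un_disjoint[symmetric]) (auto intro!: arg_cong[of _ _ card])
  then show ?thesis using card_i_of_ge[of l] card_i_of_ge[of l'] assms by simp
qed

lemma card_j_win_eq:
  assumes "j < n - t"
  shows "int (card {w \<in> win_idx d n t. j_win d n W B w = j})
    = int d ^ (n - t - j) - int d ^ (n - t - j - 1)"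
proof -
  let ?T = "\<lambda>j. {w \<in> win_idx d n t. j \<le> j_win d n W B w}"
  have "card (?T j) = card {w \<in> win_idx d n t. j_win d n W B w = j} + card (?T (Suc j))"
    by (subst card_Un_disjoint[symmetric]) (auto intro!: arg_cong[of _ _ card])
  then show ?thesis using card_j_win_ge[of j] card_j_win_ge[of "Suc j"] assms by simp
qed

text \<open>Summed over the levels \<open>j\<close> of the windows: the number of windows times the
  number of inputs has a main term independent of \<open>j\<close> and a remainder that
  telescopes.\<close>

lemma card_beta:
  assumes ph: "p \<le> h" "h \<le> n - t"
  shows "int (card {(u, w). u \<in> A_all d n a \<and> w \<in> win_idx d n t \<and>
      n - 1 - j_win d n W B w \<le> i_of d n a u \<and> i_of d n a u \<le> n - p - 1 \<and>
      p \<le> j_win d n W B w \<and> j_win d n W B w < h})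
    = int (h - p) * (int d ^ (n - t + 1) - int d ^ (n - t)) - int d ^ (n - t) + int d ^ (n - t - h + p)"
    (is "int (card ?P) = _")
proof -
  let ?j = "j_win d n W B"
  let ?V = "{w \<in> win_idx d n t. p \<le> ?j w \<and> ?j w < h}"
  let ?U = "\<lambda>j. {u \<in> A_all d n a. n - 1 - j \<le> i_of d n a u \<and> i_of d n a u < n - p}"
  \<comment> \<open>If \<open>p = h\<close> there is no window to count. Otherwise
    \<open>p < n\<close> makes \<open>i \<le> n - p - 1\<close> equivalent to
    \<open>i < n - p\<close> under truncated subtraction.\<close>
  have pn: "p < n" if "p < h" using that ph t by simp
  have "?P = prod.swap ` (SIGMA w:?V. ?U (?j w))"
    using pn by (auto simp: image_iff)
  then have "card ?P = card (SIGMA w:?V. ?U (?j w))"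
    by (simp add: card_image)
  also have "\<dots> = (\<Sum>w\<in>?V. card (?U (?j w)))" by (rule card_SigmaI) auto
  also have "\<dots> = (\<Sum>j\<in>{p..<h}. \<Sum>w | w \<in> ?V \<and> ?j w = j. card (?U (?j w)))"
    by (rule sum.group[symmetric]) auto
  also have "\<dots> = (\<Sum>j\<in>{p..<h}. card {w \<in> win_idx d n t. ?j w = j} * card (?U j))"
  proof (rule sum.cong)
    fix j assume "j \<in> {p..<h}"
    then have "{w \<in> ?V. ?j w = j} = {w \<in> win_idx d n t. ?j w = j}" by auto
    then show "(\<Sum>w | w \<in> ?V \<and> ?j w = j. card (?U (?j w)))
      = card {w \<in> win_idx d n t. ?j w = j} * card (?U j)" by simp
  qed simp
  finally have "int (card ?P)
    = (\<Sum>j\<in>{p..<h}. int (card {w \<in> win_idx d n t. ?j w = j}) * int (card (?U j)))" by simp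
  also have "\<dots> = (\<Sum>j\<in>{p..<h}. (int d ^ (n - t + 1) - int d ^ (n - t))
      - int d ^ p * (int d ^ (n - t - j) - int d ^ (n - t - Suc j)))"
  proof (rule sum.cong)
    fix j assume j: "j \<in> {p..<h}"
    have "n - (n - 1 - j) = j + 1" "n - (n - p) = p" "n - 1 - j \<le> n - p" using j ph t by auto
    then have "int (card (?U j)) = int d ^ (j + 1) - int d ^ p"
      using card_i_of_between[of "n - 1 - j" "n - p"] j by simp
    moreover have "int (card {w \<in> win_idx d n t. ?j w = j}) = int d ^ (n - t - j) - int d ^ (n - t - Suc j)"
      using card_j_win_eq[of j] j ph by simp
    moreover have "n - t - j + (j + 1) = n - t + 1" "n - t - Suc j + (j + 1) = n - t"
      using j ph by auto
    then have "int d ^ (n - t - j) * int d ^ (j + 1) = int d ^ (n - t + 1)"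
      "int d ^ (n - t - Suc j) * int d ^ (j + 1) = int d ^ (n - t)"
      by (metis power_add)+
    ultimately show "int (card {w \<in> win_idx d n t. ?j w = j}) * int (card (?U j))
      = (int d ^ (n - t + 1) - int d ^ (n - t))
        - int d ^ p * (int d ^ (n - t - j) - int d ^ (n - t - Suc j))"
      by (simp only: left_diff_distrib right_diff_distrib) (simp add: algebra_simps)
  qed simp
  also have "\<dots> = int (h - p) * (int d ^ (n - t + 1) - int d ^ (n - t))
    - int d ^ p * (\<Sum>j\<in>{p..<h}. int d ^ (n - t - j) - int d ^ (n - t - Suc j))"
    by (simp only: sum_subtractf sum_distrib_left[symmetric])
      (simp add: right_diff_distrib)
  \<comment> \<open>Telescoping; the negation brings the decreasing powers into the form
    \<open>F (Suc j) - F j\<close>.\<close>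
  also have "(\<Sum>j\<in>{p..<h}. int d ^ (n - t - j) - int d ^ (n - t - Suc j))
    = int d ^ (n - t - p) - int d ^ (n - t - h)"
    using sum_Suc_diff'[of p h "\<lambda>j. - (int d ^ (n - t - j))"] ph by simp
  also have "int d ^ p * (int d ^ (n - t - p) - int d ^ (n - t - h))
    = int d ^ (n - t) - int d ^ (n - t - h + p)"
    using ph by (simp add: right_diff_distrib add.commute flip: power_add diff_diff_left)
  finally show ?thesis by simp
qed


section \<open>Outputs sharing long prefixes with \<open>B\<close>\<close>

lemma Union_B_set:
  assumes "q \<le> n"
  shows "(\<Union>j\<in>{q..n - 1}. B_set d n B j) = {v \<in> strings d n. take q v \<in> take q ` B} - B"
    (is "?L = ?R")
proof (intro equalityI subsetI)
  fix v assume "v \<in> ?L"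
  then obtain b where v: "v \<in> strings d n" "v \<notin> B" "b \<in> B" "q \<le> lcp_length v b"
    by (auto simp: mem_B_set_iff)
  then show "v \<in> ?R" unfolding le_lcp_length_iff by blast
next
  fix v assume "v \<in> ?R"
  then obtain b where v: "v \<in> strings d n" "v \<notin> B" "b \<in> B" "take q v = take q b" by auto
  then have "b \<in> strings d n" using B_strings by auto
  \<comment> \<open>\<open>v\<close> differs from \<open>b\<close> because only \<open>b\<close>
    lies in \<open>B\<close>, so the common length is below \<open>n\<close> and stays in the index
    range.\<close>
  then have "q \<le> lcp_length v b" "lcp_length v b < n"
    using v assms by (auto simp: le_lcp_length_iff strings_def intro: lcp_length_less)
  then show "v \<in> ?L" using v by (auto simp: mem_B_set_iff intro!: bexI[of _ "lcp_length v b"])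
qed

text \<open>The outputs sharing their first \<open>q\<close> letters with \<open>B\<close> split
  into classes of size \<open>d ^ (n - q)\<close>, one for each prefix occurring in
  \<open>B\<close>; \<open>B\<close> itself lies among them.\<close>

lemma card_Union_B_set:
  assumes "q \<le> n"
  shows "int (card (\<Union>j\<in>{q..n - 1}. B_set d n B j))
    = int (card (take q ` B)) * int d ^ (n - q) - int (card B)"
proof -
  let ?P = "{v \<in> strings d n. take q v \<in> take q ` B}"
  have "?P = (\<Union>s\<in>take q ` B. {v \<in> strings d n. take q v = s})" by auto
  then have "card ?P = (\<Sum>s\<in>take q ` B. card {v \<in> strings d n. take q v = s})"
    by (simp only:) (rule card_UN_disjoint, auto)
  also have "\<dots> = (\<Sum>s\<in>take q ` B. d ^ (n - q))"
  proof (rule sum.cong)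
    fix s assume "s \<in> take q ` B"
    then have "s \<in> strings d q" using take_strings[OF _ assms] B_strings by auto
    then show "card {v \<in> strings d n. take q v = s} = d ^ (n - q)"
      using assms by (rule card_strings_prefix)
  qed simp
  finally have P: "card ?P = card (take q ` B) * d ^ (n - q)" by simp
  have BP: "B \<subseteq> ?P" using B_strings by auto
  then have "card (?P - B) = card ?P - card B" "card B \<le> card ?P"
    by (auto intro!: card_Diff_subset card_mono)
  then show ?thesis unfolding Union_B_set[OF assms] P by (simp add: of_nat_diff)
qed

text \<open>\<open>mu\<close> is the preceding count for a set of size \<open>k\<close> with as many
  distinct prefixes as possible: all \<open>d ^ (q - (n - t))\<close> extensions of the window
  prefix, or \<open>k\<close> if that is fewer.\<close>

lemma mu_eq:
  assumes "n - t \<le> q" "q \<le> n"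
  shows "mu d n t k q = int (min (d ^ (q - (n - t))) k) * int d ^ (n - q) - int k"
proof -
  have "q - (n - t) + (n - q) = t" using assms t by simp
  then have "int d ^ t = int d ^ (q - (n - t)) * int d ^ (n - q)" by (metis power_add)
  then have "mu d n t k q
    = min (int d ^ (q - (n - t)) * int d ^ (n - q)) (int k * int d ^ (n - q)) - int k"
    by (simp add: mu_def algebra_simps min_def)
  then show ?thesis by (simp add: min_mult_distrib_right of_nat_min)
qed

text \<open>Two bounds on the number of prefixes: they all extend \<open>wpre 0\<close>, and each
  comes from an element of \<open>B\<close>.\<close>

lemma card_Union_B_set_le_mu:
  assumes q: "n - t \<le> q" "q \<le> n"
  shows "int (card (\<Union>j\<in>{q..n - 1}. B_set d n B j)) \<le> mu d n t (card B) q"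
proof -
  have "take q ` B \<subseteq> {s \<in> strings d q. take (n - t) s = wpre 0}"
  proof
    fix s assume "s \<in> take q ` B"
    then obtain b where b: "b \<in> B" "s = take q b" by auto
    then have "b \<in> strings d n" "take (n - t) b = wpre 0" using B W0 by auto
    then show "s \<in> {s \<in> strings d q. take (n - t) s = wpre 0}"
      using b q take_strings[of b d n q] by (simp add: min_absorb1)
  qed
  from card_mono[OF _ this] have "card (take q ` B) \<le> d ^ (q - (n - t))"
    using card_strings_prefix[OF wpre(1)[of 0] q(1)] by simp
  moreover have "card (take q ` B) \<le> card B" by (rule card_image_le) simp
  ultimately have "int (card (take q ` B)) \<le> int (min (d ^ (q - (n - t))) (card B))" by simp
  then show ?thesis
    unfolding card_Union_B_set[OF q(2)] mu_eq[OF q] by (intro diff_right_mono mult_right_mono) auto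
qed

text \<open>The case distinction on \<open>t\<close> in \<open>S_pq\<close> and \<open>g\<close> only decides at which level \<open>h\<close> to switch
  from \<open>\<beta>\<close> (for windows with \<open>j(w) < h\<close>) to \<open>\<alpha>\<close> (for windows with \<open>j(w) \<ge> h\<close>).\<close>

definition split_level :: "nat \<Rightarrow> nat" where
  "split_level p = (if n \<le> 2 * t then n - t else max p t)"

lemma split_level: "p \<le> n - t - 1 \<Longrightarrow> p \<le> split_level p \<and> split_level p \<le> n - t"
  by (auto simp: split_level_def)

lemma ceiling_half_le: "\<lceil>real n / 2\<rceil> \<le> int t \<longleftrightarrow> n \<le> 2 * t"
  by (simp add: ceiling_le_iff) linarith

text \<open>Since \<open>j(w) < n - t\<close>, the level \<open>n - t\<close> switches every
  \<open>\<alpha>\<close> off, and the upper bounds \<open>n - t - 1\<close> in \<open>S_pq\<close>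
  hold automatically.\<close>

lemma S_pq_alpha:
  assumes "w \<in> win_idx d n t"
  shows "alpha (S_pq d n t W a B p q) w = of_bool (split_level p \<le> j_win d n W B w)"
  using j_win_less[OF assms] by (auto simp: S_pq_def split_level_def ceiling_half_le)

lemma S_pq_eps: "eps (S_pq d n t W a B p q) u = of_bool (n - p \<le> i_of d n a u)"
  by (simp add: S_pq_def)

lemma S_pq_nonneg:
  "0 \<le> alpha (S_pq d n t W a B p q) w" "0 \<le> beta (S_pq d n t W a B p q) u w"
  "0 \<le> gamma (S_pq d n t W a B p q) u" "0 \<le> delta (S_pq d n t W a B p q) v"
  "0 \<le> eps (S_pq d n t W a B p q) u"
  by (simp_all add: S_pq_def)

lemma S_pq_beta:
  assumes "w \<in> win_idx d n t"
  shows "beta (S_pq d n t W a B p q) u w = of_bool (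
    n - 1 - j_win d n W B w \<le> i_of d n a u \<and> i_of d n a u \<le> n - p - 1 \<and>
    p \<le> j_win d n W B w \<and> j_win d n W B w < split_level p)"
  using j_win_less[OF assms] by (auto simp: S_pq_def split_level_def ceiling_half_le)

text \<open>The six cases of \<open>g\<close> in one formula, with the contributions of
  \<open>\<epsilon>\<close>, \<open>\<alpha>\<close>, \<open>\<beta>\<close>, and finally of
  \<open>\<gamma>\<close> and \<open>\<delta>\<close> together, so that it can be compared with the
  objective term by term.\<close>

lemma g_eq:
  assumes p: "p \<le> n - t - 1" and q: "n - t \<le> q" "q \<le> n"
  defines "h \<equiv> split_level p"
  shows "g d n t f k p q = int f * (int d ^ p - 1) + int d ^ t * (int d ^ (n - t - h) - 1)
    + (int (h - p) * (int d ^ (n - t + 1) - int d ^ (n - t)) - int d ^ (n - t) + int d ^ (n - t - h + p))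
    + (if q = n - t then int d ^ t - int k else int d ^ q - int d ^ p + mu d n t k q)"
proof -
  consider "n \<le> 2 * t" | "2 * t < n" "p + 1 \<le> t" | "2 * t < n" "t \<le> p" by linarith
  then show ?thesis
  proof cases
    case 1
    then show ?thesis
      by (simp add: g_def Let_def ceiling_half_le h_def split_level_def)
  next
    case 2
    then have "t + (n - t - t) = n - t" "n - t - t + p = n + p - 2 * t" by auto
    then have "int d ^ t * int d ^ (n - t - t) = int d ^ (n - t)"
      "int d ^ (n - t - t + p) = int d ^ (n + p - 2 * t)" by (metis power_add, simp)
    moreover have "h = t" using 2 by (simp add: h_def split_level_def)
    ultimately show ?thesis using 2
      by (simp add: g_def Let_def ceiling_half_le right_diff_distrib)
  next
    case 3
    then have "t + (n - t - p) = n - p" "n - t - p + p = n - t" using p by auto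
    then have "int d ^ t * int d ^ (n - t - p) = int d ^ (n - p)"
      "int d ^ (n - t - p + p) = int d ^ (n - t)" by (metis power_add, simp)
    moreover have "h = p" using 3 by (simp add: h_def split_level_def)
    ultimately show ?thesis using 3
      by (simp add: g_def Let_def ceiling_half_le right_diff_distrib)
  qed
qed

section \<open>Feasibility and objective of \<open>S_pq\<close>\<close>

lemma le_j_out:
  assumes v: "v \<in> strings d n" "v \<notin> B" and b: "b \<in> B"
  shows "lcp_length v b \<le> j_out d n B v"
proof -
  have "b \<in> strings d n" using b B_strings by auto
  then have "lcp_length v b < n" using v b by (auto simp: strings_def intro: lcp_length_less)
  then show ?thesis
    unfolding j_out_def using v b by (intro Max_ge) (auto simp: mem_B_set_iff)
qed

lemma j_out_in:
  assumes v: "v \<in> strings d n" "v \<notin> B"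
  shows "j_out d n B v \<le> n - 1" "v \<in> B_set d n B (j_out d n B v)"
proof -
  let ?J = "{j \<in> {0..n - 1}. v \<in> B_set d n B j}"
  obtain b where b: "b \<in> B" using B by auto
  then have "b \<in> strings d n" using B_strings by auto
  then have "lcp_length v b < n" using v b by (auto simp: strings_def intro: lcp_length_less)
  then have "lcp_length v b \<in> ?J" using v b by (auto simp: mem_B_set_iff)
  then have "Max ?J \<in> ?J" by (intro Max_in) auto
  then show "j_out d n B v \<le> n - 1" "v \<in> B_set d n B (j_out d n B v)"
    by (auto simp: j_out_def)
qed

lemma S_pq_feasible:
  assumes p: "p \<le> n - t - 1" and q: "n - t \<le> q" "q \<le> n"
  shows "lp_feasible d n t W a B (S_pq d n t W a B p q)" (is "lp_feasible _ _ _ _ _ _ ?s")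
proof -
  have "1 \<le> alpha ?s w + beta ?s u w + eps ?s u" if "(u, w) \<in> beta_idx d n t W a B" for u w
  proof -
    have uw: "u \<in> A_all d n a" "w \<in> win_idx d n t" "n - 1 \<le> i_of d n a u + j_win d n W B w"
      using that by (auto simp: beta_idx_def)
    \<comment> \<open>\<open>\<epsilon>\<close> covers \<open>i(u) \<ge> n - p\<close> and
      \<open>\<alpha>\<close> covers \<open>j(w) \<ge> split_level p\<close>. Otherwise
      \<open>i(u) + j(w) \<ge> n - 1\<close> forces \<open>p \<le> j(w)\<close>, and
      \<open>\<beta>\<close> applies.\<close>
    show ?thesis
      unfolding S_pq_alpha[OF uw(2)] S_pq_beta[OF uw(2)] S_pq_eps
      using uw(3) i_of_less[OF uw(1)] by (auto simp: of_bool_def)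
  qed
  moreover have "1 \<le> gamma ?s u + delta ?s v + eps ?s u"
    if "u \<in> A_all d n a" "v \<in> W 0 - B" "n - 1 \<le> i_of d n a u + j_out d n B v" for u v
  proof -
    have "v \<in> strings d n" "v \<notin> B" using that W0 by auto
    note jv = j_out_in[OF this]
    \<comment> \<open>The first case is covered by \<open>\<epsilon>\<close>, the next two by
      \<open>\<delta>\<close>. In the last, \<open>j(v) < q\<close> and
      \<open>i(u) + j(v) \<ge> n - 1\<close> force \<open>i(u) \<ge> n - q\<close>, so
      \<open>\<gamma>\<close> applies.\<close>
    consider "n - p \<le> i_of d n a u" | "q = n - t" | "q \<le> j_out d n B v"
      | "i_of d n a u < n - p" "q \<noteq> n - t" "j_out d n B v < q" by linarith
    then show ?thesis
    proof cases
      case 3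
      then have "v \<in> (\<Union>j\<in>{q..n - 1}. B_set d n B j)" using jv by auto
      then show ?thesis using that by (auto simp: S_pq_def)
    next
      case 4
      then have "n - t + 1 \<le> q \<and> n - q \<le> i_of d n a u \<and> i_of d n a u \<le> n - p - 1"
        using that q by linarith
      then show ?thesis by (simp add: S_pq_def)
    qed (use that in \<open>auto simp: S_pq_def\<close>)
  qed
  ultimately show ?thesis unfolding lp_feasible_def by (auto simp add: S_pq_nonneg simp del: One_nat_def)
qed

lemma finite_beta_idx [simp]: "finite (beta_idx d n t W a B)"
  by (rule finite_subset[of _ "A_all d n a \<times> win_idx d n t"]) (auto simp: beta_idx_def)

text \<open>Only the sum of \<open>\<delta>\<close> can depend on the shape of \<open>B\<close>: for
  \<open>q > n - t\<close> it is the actual size of the union, whereas \<open>g\<close> uses the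
  maximum \<open>mu\<close>. Hence the correction term.\<close>

lemma S_pq_objective:
  assumes p: "p \<le> n - t - 1" and q: "n - t \<le> q" "q \<le> n"
  shows "lp_objective d n t f W a B (S_pq d n t W a B p q)
    = of_int (g d n t f (card B) p q - (if q = n - t then 0
        else mu d n t (card B) q - int (card (\<Union>j\<in>{q..n - 1}. B_set d n B j))))"
    (is "lp_objective _ _ _ _ _ _ _ ?s = _")
proof -
  define h where "h = split_level p"
  have h: "p \<le> h" "h \<le> n - t" using split_level[OF p] by (auto simp: h_def)
  let ?U = "\<Union>j\<in>{q..n - 1}. B_set d n B j"
  have "(\<Sum>w\<in>win_idx d n t. real d ^ t * alpha ?s w)
    = real d ^ t * (\<Sum>w\<in>win_idx d n t. of_bool (h \<le> j_win d n W B w))"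
    by (simp add: sum_distrib_left S_pq_alpha h_def)
  also have "\<dots> = of_int (int d ^ t * int (card {w \<in> win_idx d n t. h \<le> j_win d n W B w}))"
    by (subst sum_of_bool_card) simp_all
  finally have alpha: "(\<Sum>w\<in>win_idx d n t. real d ^ t * alpha ?s w)
    = of_int (int d ^ t * (int d ^ (n - t - h) - 1))"
    unfolding card_j_win_ge[OF h(2)] .
  let ?C = "\<lambda>(u, w). n - 1 - j_win d n W B w \<le> i_of d n a u \<and> i_of d n a u \<le> n - p - 1 \<and>
    p \<le> j_win d n W B w \<and> j_win d n W B w < h"
  have "(\<Sum>(u, w)\<in>beta_idx d n t W a B. beta ?s u w)
    = (\<Sum>x\<in>beta_idx d n t W a B. of_bool (?C x))"
    by (rule sum.cong) (auto simp: beta_idx_def S_pq_beta h_def)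
  also have "\<dots> = of_int (int (card {x \<in> beta_idx d n t W a B. ?C x}))"
    by (subst sum_of_bool_card) simp_all
  also have "{x \<in> beta_idx d n t W a B. ?C x} = {(u, w). u \<in> A_all d n a \<and> w \<in> win_idx d n t \<and> ?C (u, w)}"
    by (auto simp: beta_idx_def)
  finally have beta: "(\<Sum>(u, w)\<in>beta_idx d n t W a B. beta ?s u w)
    = of_int (int (h - p) * (int d ^ (n - t + 1) - int d ^ (n - t)) - int d ^ (n - t)
        + int d ^ (n - t - h + p))"
    unfolding prod.case card_beta[OF h] .
  have gamma: "(\<Sum>u\<in>A_all d n a. gamma ?s u)
    = of_int (if q = n - t then 0 else int d ^ q - int d ^ p)"
  proof (cases "q = n - t")
    case True
    then show ?thesis by (simp add: S_pq_def)
  next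
    case False
    have *: "n - (n - q) = q" "n - (n - p) = p" "n - q \<le> n - p" using p q by auto
    have "(\<Sum>u\<in>A_all d n a. gamma ?s u)
      = (\<Sum>u\<in>A_all d n a. of_bool (n - q \<le> i_of d n a u \<and> i_of d n a u < n - p))"
      using False p q t by (intro sum.cong) (auto simp: S_pq_def)
    also have "\<dots> = of_int (int (card {u \<in> A_all d n a. n - q \<le> i_of d n a u \<and> i_of d n a u < n - p}))"
      by (subst sum_of_bool_card) simp_all
    finally show ?thesis using card_i_of_between[of "n - q" "n - p"] * False by simp
  qed
  have delta: "(\<Sum>v\<in>W 0 - B. delta ?s v)
    = of_int (if q = n - t then int d ^ t - int (card B) else int (card ?U))"
  proof (cases "q = n - t")
    case True
    then have "(\<Sum>v\<in>W 0 - B. delta ?s v) = real (card (W 0 - B))" by (simp add: S_pq_def)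
    also have "card (W 0 - B) = d ^ t - card B"
      using B card_W[of 0] by (simp add: card_Diff_subset)
    finally show ?thesis using True card_B_le by (simp add: of_nat_diff)
  next
    case False
    \<comment> \<open>Sharing \<open>q \<ge> n - t\<close> letters with an element of
      \<open>B\<close> keeps an output in window \<open>0\<close>, so the sum over
      \<open>W 0 - B\<close> sees the entire union.\<close>
    have "?U \<subseteq> W 0 - B"
    proof
      fix v assume "v \<in> ?U"
      then obtain b where v: "v \<in> strings d n" "v \<notin> B" "b \<in> B" "q \<le> lcp_length v b"
        by (auto simp: mem_B_set_iff)
      then have "n - t \<le> lcp_length v b" "take (n - t) b = wpre 0" using q B W0 by auto
      then show "v \<in> W 0 - B" using v W0 unfolding le_lcp_length_iff by auto
    qed
    then have "{v \<in> W 0 - B. v \<in> ?U} = ?U" by blast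
    moreover have "(\<Sum>v\<in>W 0 - B. delta ?s v) = (\<Sum>v\<in>W 0 - B. of_bool (v \<in> ?U))"
      using False by (intro sum.cong) (auto simp: S_pq_def)
    moreover have "finite (W 0 - B)" using finite_W[of 0] by simp
    ultimately show ?thesis using False by (simp only: sum_of_bool_card) simp
  qed
  have "(\<Sum>u\<in>A_all d n a. real f * eps ?s u)
    = real f * (\<Sum>u\<in>A_all d n a. of_bool (n - p \<le> i_of d n a u))"
    by (simp add: sum_distrib_left S_pq_def)
  also have "\<dots> = of_int (int f * int (card {u \<in> A_all d n a. n - p \<le> i_of d n a u}))"
    by (subst sum_of_bool_card) simp_all
  also have "int (card {u \<in> A_all d n a. n - p \<le> i_of d n a u}) = int d ^ p - 1"
    using card_i_of_ge[of "n - p"] p t by simp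
  finally have eps: "(\<Sum>u\<in>A_all d n a. real f * eps ?s u) = of_int (int f * (int d ^ p - 1))" .
  show ?thesis
    unfolding lp_objective_def alpha beta gamma delta eps g_eq[OF p q] h_def[symmetric]
    by (simp only: of_int_add[symmetric]) (simp add: algebra_simps)
qed

text \<open>The pairs \<open>u l\<close>, \<open>v l\<close> form a 0-1 solution of the packing
  program dual to (D). \<open>meet\<close> places each pair at a constraint of (D);
  \<open>inj\<close> supplies the packing condition for \<open>\<alpha>\<close> and
  \<open>\<delta>\<close>, \<open>window\<close> that for \<open>\<beta>\<close> and
  \<open>\<gamma>\<close>, and \<open>fanout\<close> that for \<open>\<epsilon>\<close>.\<close>

lemma weak_duality:
  fixes L :: "'l set"
  assumes feas: "lp_feasible d n t W a B s" and L: "finite L"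
    and u: "\<And>l. l \<in> L \<Longrightarrow> u l \<in> A_all d n a"
    and v: "\<And>l. l \<in> L \<Longrightarrow> v l \<in> strings d n - B"
    and meet: "\<And>l. l \<in> L \<Longrightarrow> \<exists>b\<in>B. n - 1 \<le> i_of d n a (u l) + lcp_length (v l) b"
    and inj: "inj_on v L"
    and window: "\<And>l l'. l \<in> L \<Longrightarrow> l' \<in> L \<Longrightarrow> u l = u l' \<Longrightarrow>
      take (n - t) (v l) = take (n - t) (v l') \<Longrightarrow> l = l'"
    and fanout: "\<And>x. card {l \<in> L. u l = x} \<le> f"
  shows "real (card L) \<le> lp_objective d n t f W a B s"
proof -
  define L0 where "L0 = {l \<in> L. v l \<in> W 0}"
  define L1 where "L1 = L - L0"
  have fin: "finite L0" "finite L1" and sub: "L0 \<subseteq> L" "L1 \<subseteq> L"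
    and split: "L = L0 \<union> L1" "L0 \<inter> L1 = {}"
    using L by (auto simp: L0_def L1_def)
  have "\<exists>w\<in>win_idx d n t. v l \<in> W w" if l: "l \<in> L1" for l
  proof -
    have vl: "v l \<in> strings d n" "v l \<notin> W 0" using l v by (auto simp: L1_def L0_def)
    then have "take (n - t) (v l) \<in> wpre ` {0..d ^ (n - t) - 1}"
      using take_strings[of "v l" d n "n - t"] bij_betw_imp_surj_on[OF wpre_bij] by simp
    then obtain w where w: "w \<le> d ^ (n - t) - 1" "take (n - t) (v l) = wpre w" by auto
    then have "v l \<in> W w" using wpre(2)[OF w(1)] vl by simp
    moreover from this have "w \<noteq> 0" using vl by metis
    ultimately show ?thesis using w by (auto simp: win_idx_def)
  qed
  then obtain w where w: "\<And>l. l \<in> L1 \<Longrightarrow> w l \<in> win_idx d n t" "\<And>l. l \<in> L1 \<Longrightarrow> v l \<in> W (w l)"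
    by metis
  have w_pre: "take (n - t) (v l) = wpre (w l)" if "l \<in> L1" for l
    using w[OF that] wpre(2)[of "w l"] by (auto simp: win_idx_def)
  have beta_mem: "(u l, w l) \<in> beta_idx d n t W a B" if l: "l \<in> L1" for l
  proof -
    obtain b where b: "b \<in> B" "n - 1 \<le> i_of d n a (u l) + lcp_length (v l) b"
      using meet l sub by blast
    \<comment> \<open>\<open>v l\<close> lies outside window \<open>0\<close>, so the common length
      is \<open>j(w)\<close> whichever \<open>b\<close> is met.\<close>
    then have "lcp_length (v l) b = j_win d n W B (w l)"
      using lcp_other_window(1)[OF w[OF l], of b] B j_win_eq[OF w(1)[OF l]] by auto
    then show ?thesis using b u w l sub by (auto simp: beta_idx_def)
  qed
  have "1 \<le> alpha s (w l) + beta s (u l) (w l) + eps s (u l)" if "l \<in> L1" for l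
    using feas beta_mem[OF that] by (auto simp: lp_feasible_def)
  then have "(\<Sum>l\<in>L1. 1) \<le> (\<Sum>l\<in>L1. alpha s (w l) + beta s (u l) (w l) + eps s (u l))"
    by (intro sum_mono)
  then have c1: "real (card L1) \<le> (\<Sum>l\<in>L1. alpha s (w l)) + (\<Sum>l\<in>L1. beta s (u l) (w l))
      + (\<Sum>l\<in>L1. eps s (u l))"
    by (simp add: sum.distrib)
  have "1 \<le> gamma s (u l) + delta s (v l) + eps s (u l)" if l: "l \<in> L0" for l
  proof -
    obtain b where b: "b \<in> B" "n - 1 \<le> i_of d n a (u l) + lcp_length (v l) b"
      using meet l sub by blast
    have "v l \<in> W 0 - B" "v l \<in> strings d n" "v l \<notin> B" using v l by (auto simp: L0_def)
    moreover from le_j_out[OF this(2,3) b(1)]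
    have "n - 1 \<le> i_of d n a (u l) + j_out d n B (v l)" using b by simp
    ultimately show ?thesis using feas u l sub unfolding lp_feasible_def by blast
  qed
  then have "(\<Sum>l\<in>L0. 1) \<le> (\<Sum>l\<in>L0. gamma s (u l) + delta s (v l) + eps s (u l))"
    by (intro sum_mono)
  then have c0: "real (card L0) \<le> (\<Sum>l\<in>L0. gamma s (u l)) + (\<Sum>l\<in>L0. delta s (v l))
      + (\<Sum>l\<in>L0. eps s (u l))"
    by (simp add: sum.distrib)
  have "card {l \<in> L1. w l = i} \<le> d ^ t" if "i \<in> win_idx d n t" for i
  proof -
    have i: "i \<le> d ^ (n - t) - 1" using that by (auto simp: win_idx_def)
    \<comment> \<open>Distinct indices have distinct outputs, and a window has only
      \<open>d ^ t\<close> of them.\<close>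
    have "card {l \<in> L1. w l = i} \<le> card (W i)"
      using inj sub w finite_W[OF i] by (intro card_inj_on_le[of v]) (auto simp: inj_on_def)
    then show ?thesis using card_W[OF i] by simp
  qed
  then have alpha: "(\<Sum>l\<in>L1. alpha s (w l)) \<le> (\<Sum>i\<in>win_idx d n t. real d ^ t * alpha s i)"
    using sum_le_fibres[of L1 "win_idx d n t" w "d ^ t" "alpha s"] fin w feas
    by (auto simp: lp_feasible_def)
  have "(\<Sum>l\<in>L1. case_prod (beta s) (u l, w l))
    \<le> (\<Sum>i\<in>beta_idx d n t W a B. real 1 * case_prod (beta s) i)"
  proof (rule sum_le_fibres)
    show "card {l \<in> L1. (u l, w l) = i} \<le> 1" for i
    proof (rule card_fibre_inj)
      fix l l' assume l: "l \<in> L1" "l' \<in> L1" "(u l, w l) = (u l', w l')"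
      then show "l = l'" using window[of l l'] w_pre[of l] w_pre[of l'] sub by auto
    qed
  qed (use fin beta_mem feas in \<open>auto simp: lp_feasible_def\<close>)
  then have beta: "(\<Sum>l\<in>L1. beta s (u l) (w l)) \<le> (\<Sum>(u, w)\<in>beta_idx d n t W a B. beta s u w)"
    by simp
  \<comment> \<open>All outputs of \<open>L0\<close> lie in one window, so \<open>window\<close>
    makes \<open>u\<close> injective there.\<close>
  have "(\<Sum>l\<in>L0. gamma s (u l)) \<le> (\<Sum>i\<in>A_all d n a. real 1 * gamma s i)"
  proof (rule sum_le_fibres)
    show "card {l \<in> L0. u l = i} \<le> 1" for i
    proof (rule card_fibre_inj)
      fix l l' assume l: "l \<in> L0" "l' \<in> L0" "u l = u l'"
      then show "l = l'" using window[of l l'] W0 by (auto simp: L0_def)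
    qed
  qed (use fin u sub feas in \<open>auto simp: lp_feasible_def\<close>)
  then have gamma: "(\<Sum>l\<in>L0. gamma s (u l)) \<le> (\<Sum>i\<in>A_all d n a. gamma s i)" by simp
  have "(\<Sum>l\<in>L0. delta s (v l)) \<le> (\<Sum>i\<in>W 0 - B. real 1 * delta s i)"
  proof (rule sum_le_fibres)
    show "card {l \<in> L0. v l = i} \<le> 1" for i
      by (rule card_fibre_inj) (use inj sub in \<open>auto simp: inj_on_def\<close>)
    show "v ` L0 \<subseteq> W 0 - B" using v by (auto simp: L0_def)
    show "finite (W 0 - B)" using finite_W[of 0] by simp
  qed (use fin feas in \<open>auto simp: lp_feasible_def\<close>)
  then have delta: "(\<Sum>l\<in>L0. delta s (v l)) \<le> (\<Sum>i\<in>W 0 - B. delta s i)" by simp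
  have "(\<Sum>l\<in>L. eps s (u l)) \<le> (\<Sum>i\<in>A_all d n a. real f * eps s i)"
    by (rule sum_le_fibres) (use L u fanout feas in \<open>auto simp: lp_feasible_def\<close>)
  moreover have "(\<Sum>l\<in>L. eps s (u l)) = (\<Sum>l\<in>L0. eps s (u l)) + (\<Sum>l\<in>L1. eps s (u l))"
    unfolding split(1) using fin split(2) by (rule sum.union_disjoint)
  moreover have "card L = card L0 + card L1"
    using split fin by (simp add: card_Un_disjoint)
  ultimately show ?thesis
    unfolding lp_objective_def using c0 c1 alpha beta gamma delta by simp
qed

end

text \<open>Prepending the prefix of window \<open>0\<close> to the base-\<open>d\<close> digits of \<open>0, \<dots>, k - 1\<close>, least
  significant digit first, spreads the outputs as evenly as possible over the subtrees of every
  level simultaneously.\<close>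

lemma (in window_enum) spread_set:
  assumes k: "1 \<le> k" "k \<le> d ^ t"
  obtains B where "B \<subseteq> W 0" "card B = k"
    "\<And>q. n - t \<le> q \<Longrightarrow> q \<le> n \<Longrightarrow> card (take q ` B) = min (d ^ (q - (n - t))) k"
proof -
  define e where "e = (\<lambda>r x. wpre 0 @ digits d r x)"
  have d0: "0 < d" using d by simp
  have len: "length (wpre 0) = n - t" using wpre(1)[of 0] by (auto simp: strings_def)
  have card_e: "card (e r ` {..<k}) = min (d ^ r) k" for r
  proof -
    have "e r ` {..<k} = (@) (wpre 0) ` digits d r ` {..<k}" by (auto simp: e_def)
    moreover have "inj_on ((@) (wpre 0)) A" for A by (simp add: inj_on_def)
    ultimately show ?thesis using card_digits_image[OF d0] by (simp only: card_image)
  qed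
  show thesis
  proof (rule that[of "e t ` {..<k}"])
    show "e t ` {..<k} \<subseteq> W 0"
    proof
      fix y assume "y \<in> e t ` {..<k}"
      then obtain x where "y = wpre 0 @ digits d t x" by (auto simp: e_def)
      then show "y \<in> W 0"
        using append_strings[OF wpre(1)[of 0] digits_strings[OF d0, of t x]] t len W0 by simp
    qed
    show "card (e t ` {..<k}) = k" using card_e k by simp
    fix q assume q: "n - t \<le> q" "q \<le> n"
    \<comment> \<open>Cutting at \<open>q\<close> keeps the window prefix and the low digits, so at
      every level the same numbers are expanded, only to fewer digits.\<close>
    then have "take q (e t x) = e (q - (n - t)) x" for x
      using take_digits[of "q - (n - t)" t d x] t len by (simp add: e_def)
    then have "take q ` e t ` {..<k} = e (q - (n - t)) ` {..<k}" by (auto simp: image_iff)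
    then show "card (take q ` e t ` {..<k}) = min (d ^ (q - (n - t))) k" using card_e by simp
  qed
qed

section \<open>The window algorithm\<close>

text \<open>At a shared stage \<open>j\<close> the first \<open>j - 1\<close> letters of the label
  come from the outputs and the other \<open>n - j\<close> from the inputs; these lengths add up to
  \<open>n - 1\<close>.\<close>

lemma used_ses_overlap:
  assumes "1 \<le> n" "a \<in> strings d n" "u \<in> strings d n" "B \<subseteq> strings d n" "B' \<subseteq> strings d n"
    and "used_ses n (a, B, pl) \<inter> used_ses n (u, B', pl') \<noteq> {}"
  obtains b b' where "b \<in> B" "b' \<in> B'" "pl b = pl' b'"
    "n - 1 \<le> lcs_length (take (n - 1) u) (take (n - 1) a) + lcp_length b' b"
proof -
  from assms(6) obtain b b' j where b: "b \<in> B" "b' \<in> B'" "pl b = pl' b'"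
    and j: "1 \<le> j" "j \<le> n" and eq: "route_se n a b j = route_se n u b' j"
    by auto
  have len: "length a = n" "length u = n" "length b = n" "length b' = n"
    using assms b by (auto simp: strings_def)
  then have "length (take (j - 1) b) = length (take (j - 1) b')" by simp
  then have "take (j - 1) b = take (j - 1) b'"
    "drop (j - 1) (take (n - 1) a) = drop (j - 1) (take (n - 1) u)"
    using eq unfolding route_se_def by (simp_all del: length_take)
  then have "j - 1 \<le> lcp_length b' b" "n - j \<le> lcs_length (take (n - 1) u) (take (n - 1) a)"
    using len j by (auto simp: le_lcp_length_iff le_lcs_length_iff)
  then show thesis using that b j by auto
qed

section \<open>Invariants of reachable states\<close>

lemma new_request_disjoint:
  assumes "is_new_request d n f S a B" "c \<in> S"
  shows "a \<noteq> fst c \<and> B \<inter> fst (snd c) = {}"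
proof -
  have "case c of (a', B', pl') \<Rightarrow> a \<noteq> a' \<and> B \<inter> B' = {}"
    using assms unfolding is_new_request_def by blast
  then show ?thesis by (cases c) simp
qed

lemma reachable_connection:
  assumes "reachable d n m t f S" "c \<in> S"
  shows "fst c \<in> strings d n \<and> fst (snd c) \<subseteq> strings d n \<and> card (fst (snd c)) \<le> f \<and>
    follows_window_rule d n m t c"
  using assms
proof (induction arbitrary: c rule: reachable.induct)
  case (arrive S a B pl)
  show ?case
  proof (cases "c \<in> S")
    case False
    then have "c = (a, B, pl)" using arrive.prems by simp
    then show ?thesis using arrive.hyps by (simp add: is_new_request_def can_route_def)
  qed (rule arrive.IH)
qed auto

text \<open>An arriving request avoids all inputs and outputs in use, so an input or an output
  identifies its connection.\<close>

lemma reachable_distinct: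
  assumes "reachable d n m t f S" "c \<in> S" "c' \<in> S" "c \<noteq> c'"
  shows "fst c \<noteq> fst c' \<and> fst (snd c) \<inter> fst (snd c') = {}"
  using assms
proof (induction arbitrary: c c' rule: reachable.induct)
  case (arrive S a B pl)
  note new = new_request_disjoint[OF arrive.hyps(2)]
  consider "c \<in> S" "c' \<in> S" | "c = (a, B, pl)" "c' \<in> S" | "c \<in> S" "c' = (a, B, pl)"
    using arrive.prems by blast
  then show ?case
  proof cases
    case 1
    then show ?thesis using arrive.prems by (intro arrive.IH)
  next
    case 2
    then show ?thesis using new[of c'] by simp
  next
    case 3
    then show ?thesis using new[of c] by auto
  qed
qed auto

text \<open>This treats the part of the request in a single window \<open>X\<close>. If every plane
  were blocked, blocking routes indexed by the planes would give \<open>m \<le> g\<close> by weak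
  duality, against \<open>g \<le> m - 1\<close>.\<close>

lemma free_plane:
  assumes d: "2 \<le> d" and t: "t < n"
    and W: "bij_betw W {0..d ^ (n - t) - 1} (windows d n t)"
    and S: "reachable d n m t f S" and new: "is_new_request d n f S a B"
    and X: "X \<in> windows d n t" "B \<inter> X \<noteq> {}"
    and m: "1 + (MAX k\<in>{1..min f (d ^ t)}.
      MIN (p, q)\<in>{0..n - t - 1} \<times> {n - t..n}. g d n t f k p q) \<le> int m"
  obtains l where "l < m"
    "\<And>u B' pl' b b'. (u, B', pl') \<in> S \<Longrightarrow> b \<in> B \<inter> X \<Longrightarrow> b' \<in> B' \<Longrightarrow> pl' b' = l \<Longrightarrow>
      lcs_length (take (n - 1) u) (take (n - 1) a) + lcp_length b' b < n - 1"
proof (rule ccontr)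
  assume "\<not> thesis"
  with that have "\<forall>l<m. \<exists>c b'. c \<in> S \<and> b' \<in> fst (snd c) \<and> snd (snd c) b' = l \<and>
      (\<exists>b\<in>B \<inter> X. n - 1 \<le> lcs_length (take (n - 1) (fst c)) (take (n - 1) a) + lcp_length b' b)"
    by (metis fst_conv snd_conv not_less)
  then obtain c v where c: "\<And>l. l < m \<Longrightarrow> c l \<in> S" "\<And>l. l < m \<Longrightarrow> v l \<in> fst (snd (c l))"
    "\<And>l. l < m \<Longrightarrow> snd (snd (c l)) (v l) = l"
    "\<And>l. l < m \<Longrightarrow> \<exists>b\<in>B \<inter> X.
      n - 1 \<le> lcs_length (take (n - 1) (fst (c l))) (take (n - 1) a) + lcp_length (v l) b"
    by metis
  define u where "u = (\<lambda>l. fst (c l))"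
  have a: "a \<in> strings d n" and Bs: "B \<subseteq> strings d n" "card B \<le> f"
    using new by (auto simp: is_new_request_def)
  have conn: "u l \<in> strings d n" "fst (snd (c l)) \<subseteq> strings d n" "card (fst (snd (c l))) \<le> f"
    "follows_window_rule d n m t (c l)" if "l < m" for l
    using reachable_connection[OF S c(1)[OF that]] by (auto simp: u_def)
  have disj: "a \<noteq> u l" "B \<inter> fst (snd (c l)) = {}" if "l < m" for l
    using new_request_disjoint[OF new c(1)[OF that]] by (simp_all add: u_def)
  have "X \<in> W ` {0..d ^ (n - t) - 1}" using X(1) bij_betw_imp_surj_on[OF W] by simp
  then obtain i where i: "i \<in> {0..d ^ (n - t) - 1}" "W i = X" by (elim imageE) simp
  \<comment> \<open>(D) singles out window \<open>0\<close>; transposing \<open>0\<close> and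
    \<open>i\<close> re-enumerates the windows so that \<open>X\<close> takes this place.\<close>
  define \<pi> where "\<pi> = (\<lambda>w. if w = 0 then i else if w = i then 0 else w)"
  have "bij_betw \<pi> {0..d ^ (n - t) - 1} {0..d ^ (n - t) - 1}"
    by (rule bij_betw_byWitness[of _ \<pi>]) (use i in \<open>auto simp: \<pi>_def\<close>)
  from bij_betw_trans[OF this W] have W': "bij_betw (W \<circ> \<pi>) {0..d ^ (n - t) - 1} (windows d n t)" .
  have W'0: "(W \<circ> \<pi>) 0 = X" using i by (simp add: \<pi>_def)
  interpret window_lp d n t "W \<circ> \<pi>" a "B \<inter> X"
    using d t W' a X W'0 by unfold_locales auto
  define k where "k = card (B \<inter> X)"
  have "finite B" using Bs finite_strings finite_subset by blast
  then have "card (B \<inter> X) \<le> card B" by (intro card_mono) auto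
  then have "k \<in> {1..min f (d ^ t)}"
    using Bs card_B_le X(2) finite_B by (simp add: k_def Suc_le_eq card_gt_0_iff)
  then have "(MIN (p, q)\<in>{0..n - t - 1} \<times> {n - t..n}. g d n t f k p q)
      \<le> (MAX k\<in>{1..min f (d ^ t)}. MIN (p, q)\<in>{0..n - t - 1} \<times> {n - t..n}. g d n t f k p q)"
    by (intro Max_ge finite_imageI finite_atLeastAtMost imageI)
  then have "(MIN (p, q)\<in>{0..n - t - 1} \<times> {n - t..n}. g d n t f k p q) \<le> int m - 1"
    using m by linarith
  \<comment> \<open>The minimum for this \<open>k\<close> is attained at some pair \<open>p\<close>,
    \<open>q\<close>, whose solution \<open>S_pq\<close> is then used as the feasible point.\<close>
  moreover obtain x where x: "x \<in> {0..n - t - 1} \<times> {n - t..n}"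
    and "(case x of (p, q) \<Rightarrow> g d n t f k p q)
      = (MIN (p, q)\<in>{0..n - t - 1} \<times> {n - t..n}. g d n t f k p q)"
    by (rule obtains_MIN[of "{0..n - t - 1} \<times> {n - t..n}" "\<lambda>(p, q). g d n t f k p q"]) auto
  ultimately have gx: "(case x of (p, q) \<Rightarrow> g d n t f k p q) \<le> int m - 1" by linarith
  obtain p q where "x = (p, q)" by (cases x)
  then have pq: "p \<le> n - t - 1" "n - t \<le> q" "q \<le> n" and g: "g d n t f k p q \<le> int m - 1"
    using x gx by simp_all
  let ?s = "S_pq d n t (W \<circ> \<pi>) a (B \<inter> X) p q"
  have same: "c l = c l'" if "l < m" "l' < m" "u l = u l' \<or> v l = v l'" for l l'
    using reachable_distinct[OF S c(1)[OF that(1)] c(1)[OF that(2)]]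
      c(2)[OF that(1)] c(2)[OF that(2)] that(3)
    unfolding u_def by (metis disjoint_iff)
  have "real (card {..<m}) \<le> lp_objective d n t f (W \<circ> \<pi>) a (B \<inter> X) ?s"
  proof (rule weak_duality[OF S_pq_feasible[OF pq]])
    fix l assume l: "l \<in> {..<m}"
    then show uA: "u l \<in> A_all d n a" using conn(1)[of l] disj(1)[of l] by (auto simp: A_all_eq)
    show "v l \<in> strings d n - B \<inter> X" using conn(2)[of l] disj(2)[of l] c(2)[of l] l by blast
    show "\<exists>b\<in>B \<inter> X. n - 1 \<le> i_of d n a (u l) + lcp_length (v l) b"
      using c(4)[of l] l i_of_eq[OF uA] by (simp add: u_def)
  next
    \<comment> \<open>An output determines its connection, which fixes the plane serving that
      output.\<close>
    show "inj_on v {..<m}"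
    proof (rule inj_onI)
      fix l l' assume "l \<in> {..<m}" "l' \<in> {..<m}" "v l = v l'"
      then show "l = l'" using same c(3) by (metis lessThan_iff)
    qed
  next
    fix l l' assume l: "l \<in> {..<m}" "l' \<in> {..<m}" "u l = u l'"
      "take (n - t) (v l) = take (n - t) (v l')"
    then have cc: "c l = c l'" by (intro same) auto
    \<comment> \<open>Both outputs belong to one connection and one window, so the window rule puts
      them on the same plane.\<close>
    let ?Y = "{y \<in> strings d n. take (n - t) y = take (n - t) (v l)}"
    have vs: "v l \<in> strings d n" "v l' \<in> strings d n"
      using conn(2)[of l] conn(2)[of l'] c(2)[of l] c(2)[of l'] l by auto
    then have "?Y \<in> windows d n t"
      using take_strings[OF vs(1), of "n - t"] by (auto simp: windows_def)
    then obtain l0 where l0: "\<forall>b\<in>fst (snd (c l)) \<inter> ?Y. snd (snd (c l)) b = l0"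
      using conn(4)[of l] l(1) unfolding follows_window_rule_def case_prod_beta by fast
    have "v l \<in> fst (snd (c l)) \<inter> ?Y" "v l' \<in> fst (snd (c l)) \<inter> ?Y"
      using vs c(2)[of l] c(2)[of l'] l cc by auto
    from this[THEN l0[rule_format]] have "snd (snd (c l)) (v l) = snd (snd (c l)) (v l')"
      by (rule trans[OF _ sym])
    then show "l = l'" using c(3) l(1,2) cc by (metis lessThan_iff)
  next
    fix x
    show "card {l \<in> {..<m}. u l = x} \<le> f"
    proof (cases "{l \<in> {..<m}. u l = x} = {}")
      case False
      then obtain l0 where l0: "l0 < m" "u l0 = x" by auto
      \<comment> \<open>The planes blocked through input \<open>x\<close> are among those that its
        connection assigns to its outputs, of which there are at most \<open>f\<close>.\<close>
      have "{l \<in> {..<m}. u l = x} \<subseteq> snd (snd (c l0)) ` fst (snd (c l0))"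
      proof
        fix l assume "l \<in> {l \<in> {..<m}. u l = x}"
        then have "l < m" "u l = u l0" using l0 by auto
        then have "l < m" "c l = c l0" using same l0(1) by blast+
        then show "l \<in> snd (snd (c l0)) ` fst (snd (c l0))"
          using c(2,3)[of l] by (metis image_eqI)
      qed
      moreover have fin: "finite (fst (snd (c l0)))"
        using conn(2)[OF l0(1)] finite_strings finite_subset by blast
      ultimately have "card {l \<in> {..<m}. u l = x} \<le> card (fst (snd (c l0)))"
        by (meson card_image_le card_mono finite_imageI order.trans)
      then show ?thesis using conn(3)[OF l0(1)] by simp
    qed (metis card.empty zero_le)
  qed simp
  also have "\<dots> \<le> of_int (g d n t f k p q)"
    unfolding S_pq_objective[OF pq] of_int_le_iff k_def
    using card_Union_B_set_le_mu[OF pq(2,3)] by simp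
  finally have "int m \<le> g d n t f k p q" by simp
  then show False using g by simp
qed

text \<open>Windows can be treated independently: crosstalk is forbidden only between different
  inputs, so the parts of the new request do not obstruct each other.\<close>

lemma window_nonblocking_if_bound:
  assumes d: "2 \<le> d" and t: "t < n" and m1: "1 \<le> m"
    and W: "bij_betw W {0..d ^ (n - t) - 1} (windows d n t)"
    and m: "1 + (MAX k\<in>{1..min f (d ^ t)}.
      MIN (p, q)\<in>{0..n - t - 1} \<times> {n - t..n}. g d n t f k p q) \<le> int m"
  shows "window_nonblocking d n m t f"
  unfolding window_nonblocking_def
proof (intro allI impI, elim conjE)
  fix S a B assume S: "reachable d n m t f S" and new: "is_new_request d n f S a B"
  have a: "a \<in> strings d n" and Bs: "B \<subseteq> strings d n"
    using new by (auto simp: is_new_request_def)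
  let ?free = "\<lambda>X l. l < m \<and> (\<forall>u B' pl' b b'. (u, B', pl') \<in> S \<longrightarrow> b \<in> B \<inter> X \<longrightarrow> b' \<in> B' \<longrightarrow>
    pl' b' = l \<longrightarrow> lcs_length (take (n - 1) u) (take (n - 1) a) + lcp_length b' b < n - 1)"
  have "\<exists>l. ?free X l" if "X \<in> windows d n t" for X
  proof (cases "B \<inter> X = {}")
    case True
    \<comment> \<open>A window without requested outputs may take any plane;
      \<open>m \<ge> 1\<close> provides plane \<open>0\<close>.\<close>
    then show ?thesis using m1 by (intro exI[of _ 0]) auto
  next
    case False
    from free_plane[OF d t W S new that False m] show ?thesis by metis
  qed
  then obtain P where P: "\<And>X. X \<in> windows d n t \<Longrightarrow> ?free X (P X)" by metis
  define win where "win = (\<lambda>b. {y \<in> strings d n. take (n - t) y = take (n - t) b})"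
  define pl where "pl = (\<lambda>b. P (win b))"
  have win: "win b \<in> windows d n t" "b \<in> win b" if "b \<in> B" for b
    using that Bs take_strings[of b d n "n - t"] by (auto simp: win_def windows_def)
  have "follows_window_rule d n m t (a, B, pl)"
    unfolding follows_window_rule_def prod.case
  proof
    fix X assume X: "X \<in> windows d n t"
    then have "pl b = P X" if "b \<in> B \<inter> X" for b
      using that by (auto simp: pl_def win_def windows_def)
    then show "\<exists>l<m. \<forall>b\<in>B \<inter> X. pl b = l" using P[OF X] by blast
  qed
  moreover have "used_ses n (a, B, pl) \<inter> used_ses n (u, B', pl') = {}" if c: "(u, B', pl') \<in> S" for u B' pl'
  proof (rule ccontr)
    assume "used_ses n (a, B, pl) \<inter> used_ses n (u, B', pl') \<noteq> {}"
    then obtain b b' where b: "b \<in> B" "b' \<in> B'" "pl b = pl' b'"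
      "n - 1 \<le> lcs_length (take (n - 1) u) (take (n - 1) a) + lcp_length b' b"
      using used_ses_overlap[of n a d u B B' pl pl'] reachable_connection[OF S c] a Bs t by auto
    have "pl' b' = P (win b)" using b by (simp add: pl_def)
    then show False using P[OF win(1)[OF b(1)]] win(2)[OF b(1)] b c by (meson IntI not_less)
  qed
  ultimately show "\<exists>pl. can_route d n m t S (a, B, pl)"
    unfolding can_route_def by (intro exI[of _ pl]) (auto simp del: used_ses.simps)
qed

text \<open>For \<open>q > n - t\<close> the objective can depend on how \<open>B\<close> is spread
  and not only on \<open>k\<close>. Hence the bound by \<open>g\<close>, the exact value with a
  correction term, and for each \<open>k\<close> one \<open>B\<close> attaining \<open>g\<close> for
  all \<open>p\<close> and \<open>q\<close> at once.\<close>

theorem theorem5p3: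
  fixes d n m t f :: nat and W :: "nat \<Rightarrow> nat list set"
  assumes "2 \<le> d" and "1 \<le> n" and "1 \<le> m" and "t < n" and "1 \<le> f" and "f \<le> d ^ n"
    and W: "bij_betw W {0..d ^ (n - t) - 1} (windows d n t)"
  shows
    "(\<forall>a B k p q. a \<in> strings d n \<and> B \<subseteq> W 0 \<and> card B = k \<and> 1 \<le> k \<and> k \<le> min f (d ^ t) \<and>
        p \<le> n - t - 1 \<and> n - t \<le> q \<and> q \<le> n \<longrightarrow>
          lp_feasible d n t W a B (S_pq d n t W a B p q) \<and>
          lp_objective d n t f W a B (S_pq d n t W a B p q) \<le> of_int (g d n t f k p q) \<and>
          lp_objective d n t f W a B (S_pq d n t W a B p q) =
            of_int (g d n t f k p q -
              (if q = n - t then 0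
               else mu d n t k q - int (card (\<Union>j\<in>{q..n - 1}. B_set d n B j))))) \<and>
     (\<forall>a k. a \<in> strings d n \<and> 1 \<le> k \<and> k \<le> min f (d ^ t) \<longrightarrow>
        (\<exists>B\<subseteq>W 0. card B = k \<and>
          (\<forall>p q. p \<le> n - t - 1 \<and> n - t \<le> q \<and> q \<le> n \<longrightarrow>
            lp_objective d n t f W a B (S_pq d n t W a B p q) = of_int (g d n t f k p q)))) \<and>
     (int m \<ge> 1 + (MAX k\<in>{1..min f (d ^ t)}.
                     MIN (p, q)\<in>{0..n - t - 1} \<times> {n - t..n}. g d n t f k p q) \<longrightarrow>
        window_nonblocking d n m t f)"
proof (intro conjI impI allI)
  fix a B k p q
  assume *: "a \<in> strings d n \<and> B \<subseteq> W 0 \<and> card B = k \<and> 1 \<le> k \<and> k \<le> min f (d ^ t) \<and>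
    p \<le> n - t - 1 \<and> n - t \<le> q \<and> q \<le> n"
  then interpret window_lp d n t W a B
    using assms by unfold_locales auto
  have pq: "p \<le> n - t - 1" "n - t \<le> q" "q \<le> n" and k: "card B = k" using * by auto
  show "lp_feasible d n t W a B (S_pq d n t W a B p q)" by (rule S_pq_feasible[OF pq])
  show obj: "lp_objective d n t f W a B (S_pq d n t W a B p q) =
      of_int (g d n t f k p q -
        (if q = n - t then 0 else mu d n t k q - int (card (\<Union>j\<in>{q..n - 1}. B_set d n B j))))"
    using S_pq_objective[OF pq] k by simp
  show "lp_objective d n t f W a B (S_pq d n t W a B p q) \<le> of_int (g d n t f k p q)"
    unfolding obj of_int_le_iff using card_Union_B_set_le_mu[OF pq(2,3)] k by simp
next
  fix a k assume *: "a \<in> strings d n \<and> 1 \<le> k \<and> k \<le> min f (d ^ t)"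
  interpret window_enum d n t W using assms by unfold_locales
  obtain B where spread: "B \<subseteq> W 0" "card B = k"
    "\<And>q. n - t \<le> q \<Longrightarrow> q \<le> n \<Longrightarrow> card (take q ` B) = min (d ^ (q - (n - t))) k"
    using spread_set[of k] * by auto
  interpret window_lp d n t W a B
    using * spread by unfold_locales auto
  show "\<exists>B\<subseteq>W 0. card B = k \<and> (\<forall>p q. p \<le> n - t - 1 \<and> n - t \<le> q \<and> q \<le> n \<longrightarrow>
      lp_objective d n t f W a B (S_pq d n t W a B p q) = of_int (g d n t f k p q))"
  proof (intro exI[of _ B] conjI allI impI)
    fix p q assume "p \<le> n - t - 1 \<and> n - t \<le> q \<and> q \<le> n"
    then have pq: "p \<le> n - t - 1" "n - t \<le> q" "q \<le> n" by auto
    \<comment> \<open>The spread set attains the largest possible number of prefixes at every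
      \<open>q\<close>, so the correction term vanishes.\<close>
    have "int (card (\<Union>j\<in>{q..n - 1}. B_set d n B j)) = mu d n t k q"
      unfolding card_Union_B_set[OF pq(3)] mu_eq[OF pq(2,3)] spread(3)[OF pq(2,3)] spread(2) ..
    then show "lp_objective d n t f W a B (S_pq d n t W a B p q) = of_int (g d n t f k p q)"
      using S_pq_objective[OF pq] spread(2) by simp
  qed (use spread in auto)
next
  assume "int m \<ge> 1 + (MAX k\<in>{1..min f (d ^ t)}.
    MIN (p, q)\<in>{0..n - t - 1} \<times> {n - t..n}. g d n t f k p q)"
  then show "window_nonblocking d n m t f"
    by (rule window_nonblocking_if_bound[OF \<open>2 \<le> d\<close> \<open>t < n\<close> \<open>1 \<le> m\<close> W])
qed

end
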